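(* Let $n\ge1$, let $A_1,\dots,A_n$ be finite nonempty sets, and let $A_{\mathrm M}$ be the set of maps $\sigma$ on $[n]$ with $\sigma(i)\in A_i$ for all $i$. For $i\in[n]$, $a\in A_i$ let $F(\cdot\,;i,a):\mathbb{R}^n\to\mathbb{R}$, and define $f^{(\sigma)}_i(v)=F(v;i,\sigma(i))$ and $f(v)=\min_{\sigma\in A_{\mathrm M}}f^{(\sigma)}(v)$. Assume that the maps $f^{(\sigma)}$ (hence $f$) are additively homogeneous, order preserving and polyhedral. Let $\mathcal M(\sigma)=\mathrm{rec}(\mathrm{imD}(f^{(\sigma)}))$ and $\mathcal M=\bigcup_{\sigma\in A_{\mathrm M}}\mathcal M(\sigma)$ (a set of Markov matrices). Assume that every $M\in\mathcal M$ has a unique final class and that there is a state $c\in[n]$ common to all these classes, so that $$\mathcal T_{ic}:=\max_{M\in\mathcal M}\mathcal T_{ic}(M)<+\infty\quad\text{for all } i\in[n].$$ Let $K=\max_{i\in[n]}\mathcal T_{ic}$ and let $m_1$ be the cardinality of $\{(i,a)\mid i\in[n],\ a\in A_i\}$. Then the general policy iteration algorithm for the mean payoff additive eigenproblem, applied to $A_{\mathrm M},f,(f^{(\sigma)})_{\sigma\in A_{\mathrm M}}$ with distinguished state $c$, stops after at most $s_{\max}$ iterations, where $$s_{\max}:=(m_1-n)\Bigl(1+\Bigl\lfloor\frac{\log K}{\log(K/(K-1))}\Bigr\rfloor\Bigr)=\mathcal O\bigl((m_1-n)K\log K\bigr).$$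
   Context: $[n]=\{1,\dots,n\}$; $\mathbb{R}^n$ has the coordinatewise order. For $\eta\in\mathbb{R}$ and $v\in\mathbb{R}^n$, $\eta+v=(\eta+v_i)_i$. A self-map $g$ of $\mathbb{R}^n$ is order preserving if $v\le w\Rightarrow g(v)\le g(w)$; additively homogeneous if $g(\eta+v)=\eta+g(v)$ for all $\eta\in\mathbb{R}$, $v\in\mathbb{R}^n$; polyhedral if $\mathbb{R}^n$ can be covered by finitely many (full-dimensional, closed) polyhedra on each of which $g$ is affine, and then $\mathrm{imD}(g)$ is the finite set of matrices representing the differential of $g$ on each of these polyhedra. For a set $\mathcal N$ of $n\times n$ matrices, its rectangular hull $\mathrm{rec}(\mathcal N)$ is the set of matrices $N$ such that for every $i\in[n]$ the $i$-th row of $N$ is the $i$-th row of some element of $\mathcal N$. A Markov matrix is a row-stochastic matrix; a final class is a recurrent (closed communicating) class. For a Markov matrix $M$, $\mathcal T_{ij}(M)=\mathbb{E}[\inf\{k\ge1\mid X_k=j\}\mid X_0=i]$, where $(X_k)$ is a Markov chain with transition matrix $M$. General policy iteration algorithm for the mean payoff additive eigenproblem (input: $A_{\mathrm M}$ and additively homogeneous maps $f=\min_\sigma f^{(\sigma)}$, and a distinguished state $c$): (1) set $s=0$, choose $\sigma^0\in A_{\mathrm M}$ arbitrarily; (2) compute $\eta^s\in\mathbb{R}$ and $v^s\in\mathbb{R}^n$ with $\eta^s+v^s=f^{(\sigma^s)}(v^s)$ and $v^s_c=0$; (3) choose $\sigma^{s+1}\in A_{\mathrm M}$ with $f(v^s)=f^{(\sigma^{s+1})}(v^s)$,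 taking $\sigma^{s+1}=\sigma^s$ whenever possible; (4) if $\sigma^{s+1}=\sigma^s$ stop and return $\eta^s,v^s,\sigma^s$; otherwise increment $s$ and go to (2). Convention: iterations are numbered by $s$, starting from $0$; "stops after at most $s_{\max}$ iterations" means that the value of $s$ at which the algorithm stops is at most $s_{\max}$. When $K=1$ the quotient $\log K/\log(K/(K-1))$ is read as $0$. The $\mathcal O$ estimate is as $K\to\infty$ (with an absolute constant independent of $m_1-n$). *)

theory Defs
  imports "HOL-Probability.Probability" "HOL-Library.Landau_Symbols"
begin

section \<open>Self-maps of $R^n$\<close>

definition additively_homogeneous :: "(real^'n \<Rightarrow> real^'n) \<Rightarrow> bool" where
  "additively_homogeneous g \<longleftrightarrow> (\<forall>\<eta> v. g (vec \<eta> + v) = vec \<eta> + g v)"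

definition affine_with_matrix_on ::
    "(real^'n \<Rightarrow> real^'n) \<Rightarrow> (real^'n) set \<Rightarrow> real^'n^'n \<Rightarrow> bool" where
  "affine_with_matrix_on g P N \<longleftrightarrow> (\<exists>b. \<forall>x\<in>P. g x = N *v x + b)"

definition polyhedral_cover :: "(real^'n \<Rightarrow> real^'n) \<Rightarrow> (real^'n) set set \<Rightarrow> bool" where
  "polyhedral_cover g \<P> \<longleftrightarrow>
     finite \<P> \<and> \<Union>\<P> = UNIV \<and>
     (\<forall>P\<in>\<P>. polyhedron P \<and> interior P \<noteq> {} \<and> (\<exists>N. affine_with_matrix_on g P N))"

definition polyhedral_map :: "(real^'n \<Rightarrow> real^'n) \<Rightarrow> bool" where
  "polyhedral_map g \<longleftrightarrow> (\<exists>\<P>. polyhedral_cover g \<P>)"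

text \<open>
  The union over all covers only serves to avoid choosing one: by \<open>imD_cover\<close> below, every
  cover gives the same set of matrices.
\<close>
definition imD :: "(real^'n \<Rightarrow> real^'n) \<Rightarrow> (real^'n^'n) set" where
  "imD g = {N. \<exists>\<P>. polyhedral_cover g \<P> \<and> (\<exists>P\<in>\<P>. affine_with_matrix_on g P N)}"

definition rectangular_hull :: "(real^'n^'n) set \<Rightarrow> (real^'n^'n) set" where
  "rectangular_hull \<N> = {N. \<forall>i. \<exists>N'\<in>\<N>. row i N = row i N'}"

lemma affine_with_matrix_on_unique:
  fixes g :: "real^'n \<Rightarrow> real^'n"
  assumes "affine_with_matrix_on g P N" "affine_with_matrix_on g Q N'"
    and "interior (P \<inter> Q) \<noteq> {}"
  shows "N = N'"
proof -
  obtain b b' where b: "\<And>x. x \<in> P \<Longrightarrow> g x = N *v x + b"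
    and b': "\<And>x. x \<in> Q \<Longrightarrow> g x = N' *v x + b'"
    using assms(1,2) by (auto simp: affine_with_matrix_on_def)
  obtain x where x: "x \<in> interior (P \<inter> Q)" using assms(3) by blast
  then have nhd: "\<forall>\<^sub>F y in nhds x. y \<in> interior (P \<inter> Q)"
    by (intro eventually_nhds_in_open) auto
  have d: "(g has_derivative (*v) A) (at x)"
    if "\<And>y. y \<in> P \<inter> Q \<Longrightarrow> g y = A *v y + a" for A a
  proof (rule has_derivative_transform_eventually[where f = "\<lambda>y. A *v y + a"])
    show "((\<lambda>y. A *v y + a) has_derivative (*v) A) (at x)"
      by (auto intro!: derivative_eq_intros bounded_linear_imp_has_derivative
          matrix_vector_mul_bounded_linear)
    show "\<forall>\<^sub>F y in at x. A *v y + a = g y"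
      using nhd interior_subset[of "P \<inter> Q"] that
      by (auto simp: eventually_at_filter elim!: eventually_mono dest!: subsetD)
    show "A *v x + a = g x" using x interior_subset[of "P \<inter> Q"] that by fastforce
  qed auto
  have "(*v) N = (*v) N'"
  proof (rule has_derivative_unique)
    show "(g has_derivative (*v) N) (at x)" using d[of N b] b by simp
    show "(g has_derivative (*v) N') (at x)" using d[of N' b'] b' by simp
  qed
  then show ?thesis by (metis matrix_of_matrix_vector_mul)
qed

lemma interior_Union_empty:
  assumes "finite \<F>" "\<And>S. S \<in> \<F> \<Longrightarrow> closed S" "\<And>S. S \<in> \<F> \<Longrightarrow> interior S = {}"
  shows "interior (\<Union>\<F>) = {}"
  using assms
  by (induction \<F> rule: finite_induct) (auto simp: interior_closed_Un_empty_interior)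

lemma imD_cover:
  fixes g :: "real^'n \<Rightarrow> real^'n"
  assumes \<P>: "polyhedral_cover g \<P>"
  shows "imD g = {N. \<exists>P\<in>\<P>. affine_with_matrix_on g P N}"
proof (intro equalityI subsetI)
  fix N assume "N \<in> imD g"
  then obtain \<Q> Q where "polyhedral_cover g \<Q>" "Q \<in> \<Q>" and N: "affine_with_matrix_on g Q N"
    by (auto simp: imD_def)
  then have Q: "polyhedron Q" "interior Q \<noteq> {}" by (auto simp: polyhedral_cover_def)
  have "\<exists>P\<in>\<P>. interior (P \<inter> Q) \<noteq> {}"
  proof (rule ccontr)
    assume neg: "\<not> ?thesis"
    have "interior (\<Union>((\<lambda>P. P \<inter> Q) ` \<P>)) = {}"
    proof (rule interior_Union_empty)
      show "finite ((\<lambda>P. P \<inter> Q) ` \<P>)" using \<P> by (simp add: polyhedral_cover_def)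
    qed (use neg \<P> Q in \<open>auto simp: polyhedral_cover_def intro: polyhedron_imp_closed\<close>)
    moreover have "\<Union>((\<lambda>P. P \<inter> Q) ` \<P>) = Q"
      using \<P> by (auto simp: polyhedral_cover_def)
    ultimately show False using Q by metis
  qed
  then obtain P where P: "P \<in> \<P>" "interior (P \<inter> Q) \<noteq> {}" by blast
  then obtain N' where "affine_with_matrix_on g P N'"
    using \<P> by (auto simp: polyhedral_cover_def)
  with affine_with_matrix_on_unique[OF this N P(2)] P(1)
  show "N \<in> {N. \<exists>P\<in>\<P>. affine_with_matrix_on g P N}" by auto
qed (use \<P> in \<open>auto simp: imD_def\<close>)


section \<open>Finite Markov chains\<close>

definition markov_matrix :: "real^'n^'n \<Rightarrow> bool" where
  "markov_matrix M \<longleftrightarrow> (\<forall>i. (\<forall>j. 0 \<le> M $ i $ j) \<and> (\<Sum>j\<in>UNIV. M $ i $ j) = 1)"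

definition transition_rel :: "real^'n^'n \<Rightarrow> ('n \<times> 'n) set" where
  "transition_rel M = {(i, j). 0 < M $ i $ j}"

definition communicating_class :: "real^'n^'n \<Rightarrow> 'n \<Rightarrow> 'n set" where
  "communicating_class M i =
     {j. (i, j) \<in> (transition_rel M)\<^sup>* \<and> (j, i) \<in> (transition_rel M)\<^sup>*}"

definition final_class :: "real^'n^'n \<Rightarrow> 'n set \<Rightarrow> bool" where
  "final_class M C \<longleftrightarrow>
     (\<exists>i. C = communicating_class M i) \<and> transition_rel M `` C \<subseteq> C"

text \<open>
  The law, on the space of trajectories, of the chain with transition matrix $M$ started at $i$,
  obtained from the one-step kernels by the Ionescu-Tulcea theorem. It is only meaningful if $M$
  is a Markov matrix; then its values on cylinders are given by \<open>emeasure_path_measure_cylinder\<close>.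
\<close>
definition chain_kernel :: "real^'n^'n \<Rightarrow> 'n \<Rightarrow> nat \<Rightarrow> (nat \<Rightarrow> 'n) \<Rightarrow> 'n pmf" where
  "chain_kernel M i k \<omega> =
     (case k of 0 \<Rightarrow> return_pmf i | Suc l \<Rightarrow> embed_pmf (\<lambda>j. M $ \<omega> l $ j))"

lemma Ionescu_Tulcea_chain_kernel:
  fixes M :: "real^'n^'n"
  shows "Ionescu_Tulcea (\<lambda>k \<omega>. measure_pmf (chain_kernel M i k \<omega>)) (\<lambda>_. count_space UNIV)"
proof
  fix k
  have pmf: "measure_pmf \<circ> p \<in> count_space UNIV \<rightarrow>\<^sub>M subprob_algebra (count_space UNIV)"
    for p :: "'n \<Rightarrow> 'n pmf"
    by (auto simp: space_subprob_algebra measure_pmf.subprob_space_axioms)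
  show "(\<lambda>\<omega>. measure_pmf (chain_kernel M i k \<omega>))
      \<in> PiM {0..<k} (\<lambda>_. count_space UNIV) \<rightarrow>\<^sub>M subprob_algebra (count_space UNIV)"
  proof (cases k)
    case 0
    then show ?thesis
      by (simp add: chain_kernel_def space_subprob_algebra measure_pmf.subprob_space_axioms)
  next
    case (Suc l)
    have "(\<lambda>\<omega>. \<omega> l) \<in> PiM {0..<k} (\<lambda>_. count_space UNIV) \<rightarrow>\<^sub>M (count_space UNIV :: 'n measure)"
      using Suc by (intro measurable_component_singleton) auto
    from measurable_compose[OF this pmf[of "\<lambda>x. embed_pmf (\<lambda>j. M $ x $ j)"]] Suc
    show ?thesis by (simp add: chain_kernel_def)
  qed
qed

definition path_measure :: "real^'n^'n \<Rightarrow> 'n \<Rightarrow> (nat \<Rightarrow> 'n) measure" where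
  "path_measure M i =
     projective_family.lim UNIV
       (Ionescu_Tulcea.CI (\<lambda>k \<omega>. measure_pmf (chain_kernel M i k \<omega>)) (\<lambda>_. count_space UNIV))
       (\<lambda>_. count_space UNIV)"

lemma emeasure_path_measure_cylinder:
  fixes M :: "real^'n^'n"
  assumes M: "markov_matrix M"
  shows "emeasure (path_measure M i) {\<omega>. \<forall>l\<le>k. \<omega> l = x l} =
    (if x 0 = i then \<Prod>l<k. ennreal (M $ x l $ x (Suc l)) else 0)"
proof -
  let ?S = "\<lambda>_::nat. count_space (UNIV :: 'n set)"
  interpret IT: Ionescu_Tulcea "\<lambda>k \<omega>. measure_pmf (chain_kernel M i k \<omega>)" ?S
    by (rule Ionescu_Tulcea_chain_kernel)
  define J where "J n = {0..<n}" for n :: nat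
  have sing: "{restrict x (J n)} \<in> sets (PiM (J n) ?S)" for n
  proof -
    have "{restrict x (J n)} = PiE (J n) (\<lambda>l. {x l})"
      by (auto simp: PiE_def extensional_def restrict_def fun_eq_iff)
    also have "\<dots> \<in> sets (PiM (J n) ?S)"
      by (intro sets_PiM_I_finite) (auto simp: J_def)
    finally show ?thesis .
  qed
  have pmf_row: "pmf (embed_pmf (\<lambda>j. M $ y $ j)) z = M $ y $ z" for y z
  proof (rule pmf_embed_pmf)
    show "(\<integral>\<^sup>+ j. ennreal (M $ y $ j) \<partial>count_space UNIV) = 1"
      using M by (simp add: nn_integral_count_space_finite markov_matrix_def sum_ennreal)
  qed (use M in \<open>auto simp: markov_matrix_def\<close>)
  define p where "p n = emeasure (IT.C 0 n (\<lambda>_. undefined)) {restrict x (J n)}" for n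
  have "p 0 = 1"
    by (simp add: p_def J_def restrict_def PiM_empty)
  have p_Suc: "p (Suc n) = p n * ennreal (pmf (chain_kernel M i n x) (x n))" for n
  proof -
    let ?C = "IT.C 0 n (\<lambda>_. undefined)"
    have sC: "sets ?C = sets (PiM (J n) ?S)"
      using IT.sets_C[of "\<lambda>_. undefined" 0 n] by (simp add: J_def)
    have spC: "space ?C = space (PiM (J n) ?S)"
      using sC by (rule sets_eq_imp_space_eq)
    have "p (Suc n) = emeasure (?C \<bind> IT.eP n) {restrict x (J (Suc n))}"
      by (simp add: p_def)
    also have "\<dots> = (\<integral>\<^sup>+\<omega>. emeasure (IT.eP n \<omega>) {restrict x (J (Suc n))} \<partial>?C)"
    proof (rule emeasure_bind)
      show "space ?C \<noteq> {}" using spC by (simp add: J_def)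
      show "IT.eP n \<in> ?C \<rightarrow>\<^sub>M subprob_algebra (PiM (J (Suc n)) ?S)"
        using IT.measurable_eP[of n] unfolding measurable_cong_sets[OF sC refl] J_def .
    qed (rule sing)
    also have "\<dots> = (\<integral>\<^sup>+\<omega>. ennreal (pmf (chain_kernel M i n x) (x n)) *
        indicator {restrict x (J n)} \<omega> \<partial>?C)"
    proof (rule nn_integral_cong)
      fix \<omega> assume "\<omega> \<in> space ?C"
      then have w: "\<omega> \<in> space (PiM {0..<n} ?S)" and wE: "\<omega> \<in> extensional (J n)"
        using spC by (auto simp: J_def space_PiM PiE_def)
      have upd: "fun_upd \<omega> n y = restrict x (J (Suc n)) \<longleftrightarrow> \<omega> = restrict x (J n) \<and> y = x n" for y
        using wE by (auto simp: fun_eq_iff J_def extensional_def restrict_def less_Suc_eq split: if_splits)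
      have "emeasure (IT.eP n \<omega>) {restrict x (J (Suc n))} =
          emeasure (measure_pmf (chain_kernel M i n \<omega>))
            (if \<omega> = restrict x (J n) then {x n} else {})"
      proof -
        have "fun_upd \<omega> n -` {restrict x (J (Suc n))} \<inter> space (count_space UNIV) =
            (if \<omega> = restrict x (J n) then {x n} else {})"
          using upd by auto
        then show ?thesis
          using IT.emeasure_eP[OF w sing[of "Suc n", unfolded J_def]] by (simp only: J_def)
      qed
      also have "\<dots> = ennreal (pmf (chain_kernel M i n x) (x n)) * indicator {restrict x (J n)} \<omega>"
      proof (cases "\<omega> = restrict x (J n)")
        case True
        then have "chain_kernel M i n \<omega> = chain_kernel M i n x"
          by (auto simp: chain_kernel_def J_def split: nat.splits)
        with True show ?thesis by (simp add: emeasure_pmf_single)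
      qed simp
      finally show "emeasure (IT.eP n \<omega>) {restrict x (J (Suc n))} = \<dots>" .
    qed
    also have "\<dots> = p n * ennreal (pmf (chain_kernel M i n x) (x n))"
    proof -
      have "{restrict x (J n)} \<in> sets ?C" using sing[of n] sC by simp
      from nn_integral_cmult_indicator[OF this] show ?thesis
        unfolding p_def by (subst (2) mult.commute)
    qed
    finally show ?thesis .
  qed
  have p: "p (Suc n) = (if x 0 = i then \<Prod>l<n. ennreal (M $ x l $ x (Suc l)) else 0)" for n
  proof (induction n)
    case 0
    show ?case using \<open>p 0 = 1\<close> by (simp add: p_Suc chain_kernel_def)
  next
    case (Suc n)
    then show ?case by (subst p_Suc) (simp add: chain_kernel_def pmf_row)
  qed
  have "{\<omega>. \<forall>l\<le>k. \<omega> l = x l} = IT.PF.emb UNIV (J (Suc k)) {restrict x (J (Suc k))}"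
    by (auto simp: prod_emb_def J_def fun_eq_iff restrict_def less_Suc_eq_le) metis
  then have "emeasure (path_measure M i) {\<omega>. \<forall>l\<le>k. \<omega> l = x l} =
      emeasure (IT.CI (J (Suc k))) {restrict x (J (Suc k))}"
    using IT.lim[OF _ sing[of "Suc k"]] by (simp add: path_measure_def J_def)
  also have "\<dots> = emeasure (IT.C 0 (Suc k) (\<lambda>_. undefined))
      (IT.PF.emb {0..<Suc k} (J (Suc k)) {restrict x (J (Suc k))})"
    by (rule IT.emeasure_CI[OF _ sing]) (simp add: J_def)
  also have "\<dots> = p (Suc k)"
    using sing[of "Suc k"] by (simp add: J_def p_def prod_emb_id)
  finally show ?thesis by (simp add: p)
qed

text \<open>The first return time; the infimum of the empty set is \<open>\<infinity>\<close>.\<close>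
definition hitting_time :: "'n \<Rightarrow> (nat \<Rightarrow> 'n) \<Rightarrow> ennreal" where
  "hitting_time j \<omega> = (INF k\<in>{k. 1 \<le> k \<and> \<omega> k = j}. of_nat k)"

definition expected_hitting_time :: "real^'n^'n \<Rightarrow> 'n \<Rightarrow> 'n \<Rightarrow> ennreal" where
  "expected_hitting_time M i j = (\<integral>\<^sup>+\<omega>. hitting_time j \<omega> \<partial>path_measure M i)"


section \<open>Families of maps indexed by policies\<close>

definition policies :: "('n \<Rightarrow> 'a set) \<Rightarrow> ('n \<Rightarrow> 'a) set" where
  "policies A = {\<sigma>. \<forall>i. \<sigma> i \<in> A i}"

definition policy_map ::
    "(real^'n \<Rightarrow> 'n \<Rightarrow> 'a \<Rightarrow> real) \<Rightarrow> ('n \<Rightarrow> 'a) \<Rightarrow> real^'n \<Rightarrow> real^'n" where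
  "policy_map F \<sigma> v = (\<chi> i. F v i (\<sigma> i))"

text \<open>
  The minimum is taken for the coordinatewise order. Since \<open>policies A\<close> is a product set, it is
  attained at each $v$ by a single policy.
\<close>
definition min_map ::
    "('n \<Rightarrow> 'a set) \<Rightarrow> (real^'n \<Rightarrow> 'n \<Rightarrow> 'a \<Rightarrow> real) \<Rightarrow> real^'n \<Rightarrow> real^'n" where
  "min_map A F v = (\<chi> i. MIN \<sigma>\<in>policies A. policy_map F \<sigma> v $ i)"

definition matrix_family ::
    "('n \<Rightarrow> 'a set) \<Rightarrow> (real^'n \<Rightarrow> 'n \<Rightarrow> 'a \<Rightarrow> real) \<Rightarrow> (real^'n^'n) set" where
  "matrix_family A F = (\<Union>\<sigma>\<in>policies A. rectangular_hull (imD (policy_map F \<sigma>)))"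

definition max_hitting_time :: "(real^'n^'n) set \<Rightarrow> 'n \<Rightarrow> 'n \<Rightarrow> ennreal" where
  "max_hitting_time \<M> i c = (MAX M\<in>\<M>. expected_hitting_time M i c)"

text \<open>\<open>enn2real \<infinity> = 0\<close>, so this is meaningful only if all \<open>max_hitting_time \<M> i c\<close> are finite.\<close>
definition hitting_bound :: "(real^'n^'n) set \<Rightarrow> 'n \<Rightarrow> real" where
  "hitting_bound \<M> c = enn2real (MAX i\<in>UNIV. max_hitting_time \<M> i c)"


section \<open>Policy iteration for the mean payoff additive eigenproblem\<close>

text \<open>
  \<open>Evaluate s \<sigma>\<close>: about to compute $\eta^s$ and $v^s$ for $\sigma^s = \sigma$;
  \<open>Improve s \<sigma> \<eta> v\<close>: about to choose $\sigma^{s+1}$;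
  \<open>Stopped s \<sigma> \<eta> v\<close>: the algorithm has returned at iteration $s$.
\<close>
datatype ('p, 'v) pi_state =
    Evaluate nat 'p
  | Improve nat 'p real 'v
  | Stopped nat 'p real 'v

definition solves_eigenproblem ::
    "(real^'n \<Rightarrow> real^'n) \<Rightarrow> 'n \<Rightarrow> real \<Rightarrow> real^'n \<Rightarrow> bool" where
  "solves_eigenproblem g c \<eta> v \<longleftrightarrow> vec \<eta> + v = g v \<and> v $ c = 0"

definition improved_policy ::
    "'p set \<Rightarrow> (real^'n \<Rightarrow> real^'n) \<Rightarrow> ('p \<Rightarrow> real^'n \<Rightarrow> real^'n) \<Rightarrow> 'p \<Rightarrow> real^'n \<Rightarrow> 'p \<Rightarrow> bool" where
  "improved_policy AM f fp \<sigma> v \<sigma>' \<longleftrightarrow>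
     \<sigma>' \<in> AM \<and> f v = fp \<sigma>' v \<and> (f v = fp \<sigma> v \<longrightarrow> \<sigma>' = \<sigma>)"

inductive pi_step ::
    "'p set \<Rightarrow> (real^'n \<Rightarrow> real^'n) \<Rightarrow> ('p \<Rightarrow> real^'n \<Rightarrow> real^'n) \<Rightarrow> 'n \<Rightarrow>
     ('p, real^'n) pi_state \<Rightarrow> ('p, real^'n) pi_state \<Rightarrow> bool"
  for AM f fp c where
  evaluate: "solves_eigenproblem (fp \<sigma>) c \<eta> v \<Longrightarrow>
     pi_step AM f fp c (Evaluate s \<sigma>) (Improve s \<sigma> \<eta> v)"
| stop: "improved_policy AM f fp \<sigma> v \<sigma>' \<Longrightarrow> \<sigma>' = \<sigma> \<Longrightarrow>
     pi_step AM f fp c (Improve s \<sigma> \<eta> v) (Stopped s \<sigma> \<eta> v)"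
| continue: "improved_policy AM f fp \<sigma> v \<sigma>' \<Longrightarrow> \<sigma>' \<noteq> \<sigma> \<Longrightarrow>
     pi_step AM f fp c (Improve s \<sigma> \<eta> v) (Evaluate (Suc s) \<sigma>')"

text \<open>
  All choices of the algorithm are nondeterministic: whatever they are, a run is finite, it never
  gets stuck for lack of a solution in \<open>evaluate\<close> or of a policy in \<open>stop\<close>/\<open>continue\<close>, and it
  stops at an iteration $s \le N$.
\<close>
definition pi_stops_within ::
    "'p set \<Rightarrow> (real^'n \<Rightarrow> real^'n) \<Rightarrow> ('p \<Rightarrow> real^'n \<Rightarrow> real^'n) \<Rightarrow> 'n \<Rightarrow> int \<Rightarrow> bool" where
  "pi_stops_within AM f fp c N \<longleftrightarrow>
     (\<forall>\<sigma>\<^sub>0\<in>AM.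
        (\<nexists>run. run 0 = Evaluate 0 \<sigma>\<^sub>0 \<and> (\<forall>k. pi_step AM f fp c (run k) (run (Suc k)))) \<and>
        (\<forall>x. (pi_step AM f fp c)\<^sup>*\<^sup>* (Evaluate 0 \<sigma>\<^sub>0) x \<and> (\<nexists>y. pi_step AM f fp c x y) \<longrightarrow>
           (\<exists>s \<sigma> \<eta> v. x = Stopped s \<sigma> \<eta> v \<and> int s \<le> N)))"

text \<open>
  \<open>m\<close> stands for the number of pairs $(i, a)$ with $a \in A_i$, minus the number of states. At
  $K = 1$ the quotient of logarithms is read as $0$.
\<close>
definition s_max :: "nat \<Rightarrow> real \<Rightarrow> int" where
  "s_max m K = int m * (1 + \<lfloor>if K = 1 then 0 else ln K / ln (K / (K - 1))\<rfloor>)"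

end

theory Submission
  imports Defs
begin

text \<open>
  Let $\varphi_i = \max_{M} T_{ic}(M)$. Since the family of matrices is rectangular,
  $\varphi_i \ge 1 + \sum_{j \ne c} M_{ij} \varphi_j$ for all its members $M$. Substituting
  $v_i = \varphi_i (x_i - x_c)$ and $\eta = x_c$ turns the eigenproblem $\eta + v = g(v)$ into
  the fixed point problem
  $x_i = (g_i(v) + (\varphi_i - 1) x_c) / \varphi_i$, whose right-hand side is monotone and
  contracts the sup norm by $\gamma = (K - 1) / K$. Policy iteration for the eigenproblem
  is thus policy iteration for a discounted problem with factor $\gamma$, whose value vectors
  decrease and approach the optimal one geometrically. Hence every $p$ iterations, where
  $\gamma^p K < 1$, eliminate one of the $m_1 - n$ superfluous state-action pairs.
\<close>

section \<open>Policy iteration for discounted problems\<close>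

text \<open>The maps are only nonexpansive in the sup norm, and each evaluation brings its own
  unknown eigenvalue. Storing the eigenvalue in x_c settles both: as v_c = 0, only the columns other
  than \<open>c\<close> act on differences, that is, chains killed at \<open>c\<close>, and the
  weights \<phi> drop by at least 1 per step of such a chain. Row i then contracts by 1 -
  1/\<phi>_i. The factor K that \<gamma>^p has to beat is 1/(1 - \<gamma>), which bounds the ratio
  between the error of a policy and its largest defect. Since the map of a policy need not be
  affine, there is no resolvent matrix to compute with; values are compared through sub- and
  supersolutions, and matrices enter via a mean value inequality along segments. A single \<phi>
  must serve rows from different pieces and policies, which is why the family has to be
  rectangular.\<close>

lemma ex_argmax:
  fixes f :: "'a::finite \<Rightarrow> real"
  shows "\<exists>k. \<forall>j. f j \<le> f k"
proof -
  have "Max (range f) \<in> range f" by simp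
  then obtain k where "Max (range f) = f k" by (rule imageE)
  then show ?thesis by (metis Max_ge finite finite_imageI rangeI)
qed

text \<open>The case \<alpha> = 0 is monotonicity; taking \<alpha> to be the sup norm of x - y, both
  ways round, gives the contraction by \<gamma>. The one-sided form passes to minima over actions
  and is insensitive to subtracting a constant from \<open>H\<close>.\<close>

definition discounted :: "real \<Rightarrow> (('n \<Rightarrow> real) \<Rightarrow> 'n \<Rightarrow> real) \<Rightarrow> bool" where
  "discounted \<gamma> H \<longleftrightarrow>
     (\<forall>x y \<alpha> i. 0 \<le> \<alpha> \<longrightarrow> (\<forall>j. x j \<le> y j + \<alpha>) \<longrightarrow> H x i \<le> H y i + \<gamma> * \<alpha>)"

lemma discountedD:
  assumes "discounted \<gamma> H" "0 \<le> \<alpha>" "\<And>j. x j \<le> y j + \<alpha>"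
  shows "H x i \<le> H y i + \<gamma> * \<alpha>"
  using assms by (auto simp: discounted_def)

lemma discounted_mono:
  assumes "discounted \<gamma> H" "\<And>j. x j \<le> y j"
  shows "H x i \<le> H y i"
  using discountedD[OF assms(1), of 0 x y i] assms(2) by simp

text \<open>At an index where r = y - x is largest, r \<le> \<gamma> r + \<delta> unless r is
  negative. With \<delta> = 0 this compares sub- and supersolutions; with \<delta> > 0 it turns a
  defect into an error bound.\<close>

lemma discounted_compare:
  fixes H :: "('n::finite \<Rightarrow> real) \<Rightarrow> 'n \<Rightarrow> real"
  assumes H: "discounted \<gamma> H" and \<gamma>: "\<gamma> < 1"
    and sub: "\<And>i. y i \<le> H y i + \<delta>" and super: "\<And>i. H x i \<le> x i" and "0 \<le> \<delta>"
  shows "y i \<le> x i + \<delta> / (1 - \<gamma>)"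
proof -
  obtain k where k: "\<And>j. y j - x j \<le> y k - x k"
    using ex_argmax[of "\<lambda>j. y j - x j"] by blast
  have "y k - x k \<le> \<delta> / (1 - \<gamma>)"
  proof (cases "0 \<le> y k - x k")
    case True
    have "y j \<le> x j + (y k - x k)" for j using k[of j] by simp
    from H True this have "H y k \<le> H x k + \<gamma> * (y k - x k)" by (rule discountedD)
    then have "(y k - x k) * (1 - \<gamma>) \<le> \<delta>"
      using sub[of k] super[of k] by (simp add: algebra_simps)
    then show ?thesis using \<gamma> by (simp add: pos_le_divide_eq)
  next
    case False
    then have "y k - x k \<le> 0" by simp
    also have "0 \<le> \<delta> / (1 - \<gamma>)" using \<gamma> \<open>0 \<le> \<delta>\<close> by simp
    finally show ?thesis .
  qed
  with k[of i] show ?thesis by simp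
qed

text \<open>Knaster-Tarski: the infimum of the nonempty set of supersolutions is a fixed point.\<close>
lemma discounted_fixpoint:
  fixes H :: "('n::finite \<Rightarrow> real) \<Rightarrow> 'n \<Rightarrow> real"
  assumes H: "discounted \<gamma> H" and \<gamma>: "\<gamma> < 1"
  shows "\<exists>x. \<forall>i. H x i = x i"
proof -
  \<comment> \<open>Chosen so that |H 0| + \<gamma> b \<le> b: the constant b is then a
    supersolution and -b a subsolution, which keep \<open>S\<close> nonempty and bounded
    below.\<close>
  define b where "b = Max (range (\<lambda>i. \<bar>H (\<lambda>_. 0) i\<bar>)) / (1 - \<gamma>)"
  have b: "\<bar>H (\<lambda>_. 0) i\<bar> \<le> b * (1 - \<gamma>)" for i
    using \<gamma> by (simp add: b_def)
  have b0: "0 \<le> b"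
    using order_trans[OF abs_ge_zero b] \<gamma> by (simp add: zero_le_mult_iff)
  define S where "S = {x. \<forall>i. H x i \<le> x i}"
  have S_b: "(\<lambda>_. b) \<in> S"
  proof -
    have "H (\<lambda>_. b) i \<le> b" for i
      using discountedD[OF H b0, of "\<lambda>_. b" "\<lambda>_. 0" i] b[of i] by (simp add: algebra_simps)
    then show ?thesis by (simp add: S_def)
  qed
  have sub: "- b \<le> H (\<lambda>_. - b) i" for i
    using discountedD[OF H b0, of "\<lambda>_. 0" "\<lambda>_. - b" i] b[of i] by (simp add: algebra_simps)
  have lower: "- b \<le> x i" if "x \<in> S" for x i
    using discounted_compare[OF H \<gamma>, of "\<lambda>_. - b" 0 x i] sub that by (simp add: S_def)
  define x where "x i = (INF y\<in>S. y i)" for i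
  have bdd: "bdd_below ((\<lambda>y. y i) ` S)" for i
    using lower by (intro bdd_belowI[of _ "- b"]) auto
  have x_le: "x i \<le> y i" if "y \<in> S" for y i
    unfolding x_def using bdd that by (rule cINF_lower)
  have le_x: "H x i \<le> x i" for i
    unfolding x_def[of i]
  proof (rule cINF_greatest)
    show "S \<noteq> {}" using S_b by blast
    fix y assume y: "y \<in> S"
    have "H x i \<le> H y i" by (rule discounted_mono[OF H x_le[OF y]])
    also have "\<dots> \<le> y i" using y by (simp add: S_def)
    finally show "H x i \<le> y i" .
  qed
  then have "H x \<in> S" using discounted_mono[OF H] by (auto simp: S_def)
  then have "x i \<le> H x i" for i by (rule x_le)
  with le_x show ?thesis by (metis antisym)
qed

text \<open>A policy that is greedy for \<open>y\<close> bounds the minimum at \<open>x\<close> from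
  above. The hypothesis can thus speak of whole policies, as for the original maps, instead of
  single actions.\<close>

lemma discounted_Min:
  fixes A :: "'n \<Rightarrow> 'a set"
  assumes fin: "\<And>i. finite (A i)" "\<And>i. A i \<noteq> {}"
    and G: "\<And>\<sigma>. \<sigma> \<in> policies A \<Longrightarrow> discounted \<gamma> (\<lambda>x i. G x i (\<sigma> i))"
  shows "discounted \<gamma> (\<lambda>x i. MIN a\<in>A i. G x i a)"
  unfolding discounted_def
proof (intro allI impI)
  fix x y :: "'n \<Rightarrow> real" and \<alpha> :: real and i
  assume \<alpha>: "0 \<le> \<alpha>" and xy: "\<forall>j. x j \<le> y j + \<alpha>"
  define \<sigma> where "\<sigma> j = (SOME a. a \<in> A j \<and> G y j a = (MIN a\<in>A j. G y j a))" for j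
  have \<sigma>: "\<sigma> j \<in> A j \<and> G y j (\<sigma> j) = (MIN a\<in>A j. G y j a)" for j
  proof -
    have "(MIN a\<in>A j. G y j a) \<in> G y j ` A j" using fin by (intro Min_in) auto
    then have "\<exists>a. a \<in> A j \<and> G y j a = (MIN a\<in>A j. G y j a)" by force
    then show ?thesis unfolding \<sigma>_def by (rule someI_ex)
  qed
  have "(MIN a\<in>A i. G x i a) \<le> G x i (\<sigma> i)" using fin \<sigma> by simp
  also have "\<dots> \<le> G y i (\<sigma> i) + \<gamma> * \<alpha>"
    using discountedD[OF G \<alpha>, of \<sigma> x y i] \<sigma> xy by (simp add: policies_def)
  finally show "(MIN a\<in>A i. G x i a) \<le> (MIN a\<in>A i. G y i a) + \<gamma> * \<alpha>" using \<sigma> by simp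
qed

text \<open>
  Write $x^*$ for the optimal value and $d_i(a) = G_i(x^*, a) - x^*_i \ge 0$ for the defect of an
  action. The maximal defect $\delta$ of the $t$-th policy satisfies
  $x^t - x^* \le \delta / (1 - \gamma)$, whereas the defects of every later policy $u$
  are bounded by $\max (x^u - x^*)$, which decreases geometrically. So an action of maximal defect of
  the $t$-th policy is not used from $t + p$ on, and it is not optimal either.
\<close>
lemma policy_iteration_length:
  fixes A :: "'n::finite \<Rightarrow> 'a set" and G :: "('n \<Rightarrow> real) \<Rightarrow> 'n \<Rightarrow> 'a \<Rightarrow> real"
  assumes fin: "\<And>i. finite (A i)" "\<And>i. A i \<noteq> {}"
    and G: "\<And>\<sigma>. \<sigma> \<in> policies A \<Longrightarrow> discounted \<gamma> (\<lambda>x i. G x i (\<sigma> i))"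
    and \<gamma>: "0 \<le> \<gamma>" "\<gamma> < 1" and p: "\<gamma> ^ p < 1 - \<gamma>"
    and \<tau>: "\<And>t. t \<le> s \<Longrightarrow> \<tau> t \<in> policies A"
    and x: "\<And>t i. t < s \<Longrightarrow> G (x t) i (\<tau> t i) = x t i"
    and greedy: "\<And>t i a. t < s \<Longrightarrow> a \<in> A i \<Longrightarrow> G (x t) i (\<tau> (Suc t) i) \<le> G (x t) i a"
    and improving: "\<And>t. t < s \<Longrightarrow> \<exists>i. \<exists>a\<in>A i. G (x t) i a < G (x t) i (\<tau> t i)"
  shows "s \<le> (card (SIGMA i:UNIV. A i) - CARD('n)) * p"
proof (rule ccontr)
  let ?N = "card (SIGMA i:UNIV. A i) - CARD('n)"
  assume "\<not> s \<le> ?N * p"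
  then have s: "?N * p < s" by simp
  have "p > 0" using p \<gamma> by (cases p) auto
  define H where "H y i = (MIN a\<in>A i. G y i a)" for y i
  have H: "discounted \<gamma> H"
    using discounted_Min[OF fin G] unfolding H_def .
  obtain z where z: "\<And>i. H z i = z i"
    using discounted_fixpoint[OF H \<gamma>(2)] by blast
  have H_le: "H y i \<le> G y i a" if "a \<in> A i" for y i a
    unfolding H_def using fin that by simp
  have H_att: "\<exists>a\<in>A i. G y i a = H y i" for y i
  proof -
    have "H y i \<in> G y i ` A i" unfolding H_def using fin by (intro Min_in) auto
    then show ?thesis by force
  qed
  have H_greedy: "G (x t) i (\<tau> (Suc t) i) = H (x t) i" if "t < s" for t i
  proof (rule antisym)
    show "G (x t) i (\<tau> (Suc t) i) \<le> H (x t) i" using H_att[of i "x t"] greedy[OF that] by metis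
    show "H (x t) i \<le> G (x t) i (\<tau> (Suc t) i)"
      using \<tau>[of "Suc t"] that by (intro H_le) (simp add: policies_def)
  qed
  have \<tau>A: "\<tau> t i \<in> A i" if "t \<le> s" for t i using \<tau>[OF that] by (simp add: policies_def)
  have z_le: "z i \<le> x t i" if "t < s" for t i
    using discounted_compare[OF H \<gamma>(2), of z 0 "x t" i] z H_le[OF \<tau>A] x[OF that] that
    by (simp add: less_imp_le) (metis less_imp_le)
  define e where "e t = (MAX i. x t i - z i)" for t
  have e: "x t i - z i \<le> e t" for t i by (simp add: e_def)
  have e_att: "\<exists>i. e t = x t i - z i" for t
    unfolding e_def using Max_in[of "range (\<lambda>i. x t i - z i)"] by fastforce
  have e_nonneg: "0 \<le> e t" if "t < s" for t using e_att[of t] z_le[OF that] by auto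
  \<comment> \<open>The old value vector is a supersolution for the new policy, so values decrease;
    monotonicity then puts the new value below \<open>H (x t)\<close>, and \<open>H\<close>
    contracts towards \<open>z\<close>.\<close>
  have e_Suc: "e (Suc t) \<le> \<gamma> * e t" if t: "Suc t < s" for t
  proof -
    have ts: "t < s" using t by simp
    have sup: "G (x t) j (\<tau> (Suc t) j) \<le> x t j" for j
      using greedy[OF ts \<tau>A] x[OF ts] ts by (metis less_imp_le)
    have D: "discounted \<gamma> (\<lambda>x i. G x i (\<tau> (Suc t) i))" using G \<tau> t by simp
    have le: "x (Suc t) j \<le> x t j" for j
      using discounted_compare[OF D \<gamma>(2), of "x (Suc t)" 0 "x t" j] x[OF t] sup by simp
    obtain i where i: "e (Suc t) = x (Suc t) i - z i" using e_att by blast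
    have "x (Suc t) i = G (x (Suc t)) i (\<tau> (Suc t) i)" using x[OF t] by simp
    also have "\<dots> \<le> G (x t) i (\<tau> (Suc t) i)" using discounted_mono[OF D le] .
    also have "\<dots> = H (x t) i" by (rule H_greedy[OF ts])
    also have "\<dots> \<le> H z i + \<gamma> * e t"
      by (rule discountedD[OF H e_nonneg[OF ts]]) (use e[of t] in \<open>simp add: algebra_simps\<close>)
    finally show ?thesis using z i by simp
  qed
  have e_pow: "e (t + k) \<le> \<gamma> ^ k * e t" if "t + k < s" for t k
    using that
  proof (induction k)
    case (Suc k)
    have "e (t + Suc k) \<le> \<gamma> * e (t + k)" using e_Suc[of "t + k"] Suc.prems by simp
    also have "\<dots> \<le> \<gamma> * (\<gamma> ^ k * e t)" using Suc \<gamma> by (intro mult_left_mono) auto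
    finally show ?case by (simp add: mult_ac)
  qed simp
  define d where "d i a = G z i a - z i" for i a
  have d_le: "d i (\<tau> t i) \<le> e t" if "t < s" for i t
  proof -
    have "G z i (\<tau> t i) \<le> G (x t) i (\<tau> t i)"
      using discounted_mono[OF G[OF \<tau>] z_le] that by (meson less_imp_le)
    then show ?thesis using x[OF that] e[of t i] by (simp add: d_def)
  qed
  have "\<exists>i. 0 < d i (\<tau> t i) \<and> e t \<le> d i (\<tau> t i) / (1 - \<gamma>)" if t: "t < s" for t
  proof -
    obtain i where i: "\<And>j. d j (\<tau> t j) \<le> d i (\<tau> t i)"
      using ex_argmax[of "\<lambda>j. d j (\<tau> t j)"] by blast
    have D: "discounted \<gamma> (\<lambda>x i. G x i (\<tau> t i))" using G \<tau> t by simp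
    have d0: "0 \<le> d i (\<tau> t i)" using H_le[OF \<tau>A, of t z i] t z by (simp add: d_def)
    \<comment> \<open>Lowered by the maximal defect, the operator of the policy has \<open>z\<close>
      as a supersolution, while \<open>x t\<close> is a subsolution up to that same defect.\<close>
    have "discounted \<gamma> (\<lambda>x j. G x j (\<tau> t j) - d i (\<tau> t i))"
      using D by (simp add: discounted_def)
    then have x_z: "x t j \<le> z j + d i (\<tau> t i) / (1 - \<gamma>)" for j
    proof (rule discounted_compare[OF _ \<gamma>(2)])
      show "G z k (\<tau> t k) - d i (\<tau> t i) \<le> z k" for k using i[of k] by (simp add: d_def)
    qed (use x[OF t] d0 in auto)
    have e_d: "e t \<le> d i (\<tau> t i) / (1 - \<gamma>)"
    proof -
      obtain j where "e t = x t j - z j" using e_att by blast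
      then show ?thesis using x_z[of j] by simp
    qed
    \<comment> \<open>A policy without defect would be optimal, and no action could improve on it
      strictly.\<close>
    have "d i (\<tau> t i) \<noteq> 0"
    proof
      assume "d i (\<tau> t i) = 0"
      then have "e t \<le> 0" using e_d by simp
      then have eq: "x t = z"
      proof (intro ext antisym)
        show "x t j \<le> z j" for j using e[of t j] \<open>e t \<le> 0\<close> by simp
      qed (rule z_le[OF t])
      obtain k a where "a \<in> A k" "G (x t) k a < G (x t) k (\<tau> t k)" using improving[OF t] by blast
      with H_le[of a k z] show False using eq z x[OF t] by simp
    qed
    with d0 e_d show ?thesis by (intro exI[of _ i] conjI) simp_all
  qed
  then obtain w where w: "\<And>t. t < s \<Longrightarrow> 0 < d (w t) (\<tau> t (w t))"
    "\<And>t. t < s \<Longrightarrow> e t \<le> d (w t) (\<tau> t (w t)) / (1 - \<gamma>)" by metis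
  \<comment> \<open>One sample every \<open>p\<close> iterations. Since s > N p, the N + 1 times 0,
    p, ..., N p all precede \<open>s\<close>. With the n pairs of an optimal policy they yield N + 1
    + n distinct pairs, more than there are.\<close>
  define q where "q k = (w (k * p), \<tau> (k * p) (w (k * p)))" for k
  have kp: "k * p < s" if "k \<le> ?N" for k
    using s that by (meson le_less_trans mult_le_mono1)
  have distinct: "q k \<noteq> q l" if kl: "k < l" "l \<le> ?N" for k l
  proof
    assume eq: "q k = q l"
    let ?d = "d (w (k * p)) (\<tau> (k * p) (w (k * p)))"
    have k: "k * p < s" using kl by (intro kp) simp
    obtain r where r: "l = k + 1 + r" using kl less_imp_add_positive[of k l]
      by (metis add.assoc add.commute less_iff_Suc_add plus_1_eq_Suc)
    have l: "l * p = k * p + (p + r * p)" using r by (simp add: algebra_simps)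
    have "?d \<le> e (l * p)" using eq d_le[OF kp[OF kl(2)]] unfolding q_def by (metis prod.inject)
    also have "\<dots> \<le> \<gamma> ^ (p + r * p) * e (k * p)" using e_pow kp[OF kl(2)] unfolding l .
    also have "\<dots> \<le> \<gamma> ^ p * e (k * p)"
      using \<gamma> e_nonneg[OF k] by (intro mult_right_mono power_decreasing) auto
    also have "\<dots> \<le> \<gamma> ^ p * (?d / (1 - \<gamma>))"
      using \<gamma> w(2)[OF k] by (intro mult_left_mono) auto
    also have "\<dots> < (1 - \<gamma>) * (?d / (1 - \<gamma>))"
      using p w(1)[OF k] \<gamma> by (intro mult_strict_right_mono) auto
    also have "\<dots> = ?d" using \<gamma> by simp
    finally show False by simp
  qed
  have inj: "inj_on q {..?N}"
    by (rule inj_onI) (metis atMost_iff distinct linorder_neqE_nat)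
  obtain \<rho> where \<rho>: "\<And>i. \<rho> i \<in> A i" "\<And>i. G z i (\<rho> i) = z i"
    using H_att[of _ z] z by metis
  let ?R = "range (\<lambda>i. (i, \<rho> i))"
  have disj: "q ` {..?N} \<inter> ?R = {}"
  proof (rule ccontr)
    assume "q ` {..?N} \<inter> ?R \<noteq> {}"
    then obtain k where "k \<le> ?N" "\<tau> (k * p) (w (k * p)) = \<rho> (w (k * p))" by (auto simp: q_def)
    with w(1)[OF kp] \<rho>(2) show False by (metis d_def diff_self less_irrefl)
  qed
  have sub: "q ` {..?N} \<union> ?R \<subseteq> (SIGMA i:UNIV. A i)"
    using \<rho>(1) \<tau>A kp by (auto simp: q_def less_imp_le)
  have finS: "finite (SIGMA i:UNIV. A i)" using fin by auto
  have "card (q ` {..?N} \<union> ?R) = Suc ?N + CARD('n)"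
    using disj inj by (subst card_Un_disjoint) (auto simp: card_image inj_on_def)
  with card_mono[OF finS sub] show False by simp
qed

section \<open>Hitting times of finite Markov chains\<close>

text \<open>Among the states reachable from \<open>i\<close>, one that reaches the fewest states can
  be reached back from everything it leads to, so its class is closed. If every final class contains
  \<open>c\<close>, then \<open>c\<close> is reachable from everywhere.\<close>

lemma final_class_reachable:
  fixes M :: "real^'n^'n"
  shows "\<exists>C. final_class M C \<and> (\<forall>j\<in>C. (i, j) \<in> (transition_rel M)\<^sup>*)"
proof -
  let ?R = "transition_rel M"
  define reach where "reach j = {k. (j, k) \<in> ?R\<^sup>*}" for j
  obtain j where j: "j \<in> reach i" and min: "\<And>k. k \<in> reach i \<Longrightarrow> card (reach j) \<le> card (reach k)"
    using ex_has_least_nat[of "\<lambda>j. j \<in> reach i" i "\<lambda>j. card (reach j)"] by (auto simp: reach_def)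
  have return: "(k, j) \<in> ?R\<^sup>*" if "(j, k) \<in> ?R\<^sup>*" for k
  proof -
    have "reach k \<subseteq> reach j" using that by (auto simp: reach_def)
    moreover have "k \<in> reach i" using that j by (auto simp: reach_def)
    ultimately have "reach k = reach j" using min by (intro card_seteq) auto
    then show ?thesis by (auto simp: reach_def)
  qed
  have "final_class M (communicating_class M j)"
    unfolding final_class_def communicating_class_def
    using return by (auto intro: rtrancl_into_rtrancl)
  then show ?thesis
    using j by (intro exI[of _ "communicating_class M j"]) (auto simp: reach_def communicating_class_def)
qed

text \<open>The transition matrix of the chain killed on entering \<open>c\<close>. Only the column
  of \<open>c\<close> is deleted, not the row: a chain started at \<open>c\<close> still runs until
  its first return.\<close>

definition taboo_apply :: "real^'n^'n \<Rightarrow> 'n \<Rightarrow> ('n \<Rightarrow> real) \<Rightarrow> 'n \<Rightarrow> real" where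
  "taboo_apply M c y i = (\<Sum>j\<in>UNIV - {c}. M $ i $ j * y j)"

lemma taboo_apply_mono:
  assumes "markov_matrix M" "\<And>j. x j \<le> y j"
  shows "taboo_apply M c x i \<le> taboo_apply M c y i"
  unfolding taboo_apply_def using assms
  by (intro sum_mono mult_left_mono) (auto simp: markov_matrix_def)

lemma taboo_apply_diff:
  "taboo_apply M c (\<lambda>j. x j - y j) i = taboo_apply M c x i - taboo_apply M c y i"
  by (simp add: taboo_apply_def right_diff_distrib sum_subtractf)

lemma taboo_apply_minus: "taboo_apply M c (\<lambda>j. - x j) i = - taboo_apply M c x i"
  by (simp add: taboo_apply_def sum_negf)

text \<open>A positive maximum would be passed on to all successors of a maximal state, and none of
  these could be \<open>c\<close>, where the killed chain carries the value 0. So maximal states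
  would never lead to \<open>c\<close>.\<close>

lemma taboo_maximum_principle:
  fixes M :: "real^'n^'n"
  assumes M: "markov_matrix M" and reach: "\<And>i. (i, c) \<in> (transition_rel M)\<^sup>*"
    and y: "\<And>i. y i \<le> taboo_apply M c y i"
  shows "y i \<le> 0"
proof (rule ccontr)
  assume "\<not> y i \<le> 0"
  obtain k where k: "\<And>j. y j \<le> y k" using ex_argmax[of y] by blast
  have pos: "0 < y k" using k[of i] \<open>\<not> y i \<le> 0\<close> by simp
  have succ: "l \<noteq> c \<and> y l = y k" if h: "y h = y k" and hl: "(h, l) \<in> transition_rel M" for h l
  proof -
    \<comment> \<open>These terms are nonnegative and sum to at most 0. The one for j = c is M_hc
      y_k, which rules out a transition to \<open>c\<close>.\<close>
    define u where "u j = M $ h $ j * (y k - (if j = c then 0 else y j))" for j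
    have u0: "0 \<le> u j" for j
      using M k[of j] pos by (auto simp: u_def markov_matrix_def intro!: mult_nonneg_nonneg)
    have "taboo_apply M c y h = (\<Sum>j\<in>UNIV. M $ h $ j * (if j = c then 0 else y j))"
      unfolding taboo_apply_def by (rule sum.mono_neutral_cong_left) auto
    then have "(\<Sum>j\<in>UNIV. u j) = (\<Sum>j\<in>UNIV. M $ h $ j) * y k - taboo_apply M c y h"
      by (simp add: u_def right_diff_distrib sum_subtractf sum_distrib_right)
    also have "\<dots> \<le> 0" using M y[of h] h by (simp add: markov_matrix_def)
    finally have "(\<Sum>j\<in>UNIV. u j) = 0" using u0 by (simp add: antisym sum_nonneg)
    then have "u l = 0" using u0 sum_nonneg_eq_0_iff[of UNIV u] by simp
    moreover have "M $ h $ l > 0" using hl by (simp add: transition_rel_def)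
    ultimately show ?thesis using pos by (auto simp: u_def split: if_splits)
  qed
  \<comment> \<open>The path to \<open>c\<close> has to start at a successor of \<open>k\<close>: if
    \<open>k\<close> is \<open>c\<close> itself, the empty path would give no contradiction.\<close>
  have "\<exists>l. M $ k $ l \<noteq> 0"
  proof (rule ccontr)
    assume "\<not> ?thesis"
    then have "(\<Sum>j\<in>UNIV. M $ k $ j) = 0" by simp
    with M show False by (simp add: markov_matrix_def)
  qed
  then obtain l where "M $ k $ l \<noteq> 0" ..
  then have "(k, l) \<in> transition_rel M"
    using M by (auto simp: transition_rel_def markov_matrix_def less_le)
  then have l: "l \<noteq> c" "y l = y k" using succ[of k l] by blast+
  have "m \<noteq> c \<and> y m = y k" if "(l, m) \<in> (transition_rel M)\<^sup>*" for m
    using that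
  proof induction
    case (step m m')
    then show ?case using succ[of m m'] by blast
  qed (use l in blast)
  with reach[of l] show False by blast
qed

text \<open>The tail P(T > k) of the first return time T to \<open>c\<close>, as identified in
  \<open>emeasure_avoid\<close>. Time 0 is not inspected, hence the start value 1 also at
  \<open>c\<close>.\<close>

primrec avoid_prob :: "real^'n^'n \<Rightarrow> 'n \<Rightarrow> nat \<Rightarrow> 'n \<Rightarrow> real" where
  "avoid_prob M c 0 = (\<lambda>_. 1)"
| "avoid_prob M c (Suc k) = taboo_apply M c (avoid_prob M c k)"

lemma avoid_prob_nonneg: "markov_matrix M \<Longrightarrow> 0 \<le> avoid_prob M c k i"
proof (induction k arbitrary: i)
  case (Suc k)
  then show ?case
    by (auto simp: taboo_apply_def markov_matrix_def intro!: sum_nonneg mult_nonneg_nonneg)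
qed simp

section \<open>Avoidance events under the path measure\<close>

lemma sets_path_measure: "sets (path_measure M i) = sets (PiM UNIV (\<lambda>_. count_space UNIV))"
proof -
  interpret IT: Ionescu_Tulcea "\<lambda>k \<omega>. measure_pmf (chain_kernel M i k \<omega>)" "\<lambda>_. count_space UNIV"
    by (rule Ionescu_Tulcea_chain_kernel)
  show ?thesis unfolding path_measure_def by (rule IT.PF.sets_lim)
qed

lemma space_path_measure: "space (path_measure M i) = UNIV"
  using sets_eq_imp_space_eq[OF sets_path_measure[of M i]] by (simp add: space_PiM PiE_UNIV_domain)

lemma coordinate_set_measurable:
  "{\<omega>. \<omega> l = (j::'n::finite)} \<in> sets (path_measure M i)"
proof -
  have "(\<lambda>\<omega>. \<omega> l) -` {j} \<inter> space (PiM UNIV (\<lambda>_. count_space UNIV)) \<in> sets (PiM UNIV (\<lambda>_. count_space UNIV))"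
    by (rule measurable_sets[OF measurable_component_singleton]) auto
  then show ?thesis by (simp add: sets_path_measure space_PiM PiE_UNIV_domain vimage_def)
qed

lemma cylinder_avoid_measurable:
  fixes M :: "real^'n^'n"
  shows "{\<omega>. (\<forall>l\<le>k. \<omega> l = x l) \<and> (\<forall>l\<in>{a..b}. \<omega> l \<noteq> c)} \<in> sets (path_measure M i)"
proof -
  have "{\<omega>. (\<forall>l\<le>k. \<omega> l = x l) \<and> (\<forall>l\<in>{a..b}. \<omega> l \<noteq> c)} =
      {\<omega>\<in>space (path_measure M i). (\<forall>l\<in>{..k}. \<omega> l = x l) \<and> (\<forall>l\<in>{a..b}. \<not> \<omega> l = c)}"
    by (auto simp: space_path_measure)
  also have "\<dots> \<in> sets (path_measure M i)"
    using coordinate_set_measurable[of _ _ M i]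
    by (intro sets.sets_Collect_conj sets.sets_Collect_finite_All sets.sets_Collect_neg)
      (auto simp: space_path_measure)
  finally show ?thesis .
qed

text \<open>This is the Markov property, by induction on \<open>m\<close>: splitting by the next
  state j \<noteq> c lengthens the prefix by one, which is why \<open>k\<close> and \<open>x\<close>
  are arbitrary.\<close>

lemma emeasure_cylinder_avoid:
  fixes M :: "real^'n^'n"
  assumes M: "markov_matrix M"
  shows "emeasure (path_measure M i) {\<omega>. (\<forall>l\<le>k. \<omega> l = x l) \<and> (\<forall>l\<in>{Suc k..k + m}. \<omega> l \<noteq> c)} =
    emeasure (path_measure M i) {\<omega>. \<forall>l\<le>k. \<omega> l = x l} * ennreal (avoid_prob M c m (x k))"
proof (induction m arbitrary: k x)
  case (Suc m)
  let ?P = "path_measure M i"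
  define x' where "x' j = x(Suc k := j)" for j
  define B where "B j = {\<omega>. (\<forall>l\<le>Suc k. \<omega> l = x' j l) \<and> (\<forall>l\<in>{Suc (Suc k)..Suc k + m}. \<omega> l \<noteq> c)}" for j
  define E where "E = emeasure ?P {\<omega>. \<forall>l\<le>k. \<omega> l = x l}"
  have eB: "emeasure ?P (B j) = E * ennreal (M $ x k $ j * avoid_prob M c m j)" for j
  proof -
    have "emeasure ?P {\<omega>. \<forall>l\<le>Suc k. \<omega> l = x' j l} = E * ennreal (M $ x k $ j)"
    proof -
      have "(\<Prod>l<k. ennreal (M $ x' j l $ x' j (Suc l))) = (\<Prod>l<k. ennreal (M $ x l $ x (Suc l)))"
        by (intro prod.cong) (auto simp: x'_def)
      then show ?thesis
        by (simp add: emeasure_path_measure_cylinder[OF M] E_def x'_def)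
    qed
    with Suc.IH[of "Suc k" "x' j"] show ?thesis
      using M by (simp add: B_def x'_def ennreal_mult' mult.assoc markov_matrix_def)
  qed
  have "{\<omega>. (\<forall>l\<le>k. \<omega> l = x l) \<and> (\<forall>l\<in>{Suc k..k + Suc m}. \<omega> l \<noteq> c)} = (\<Union>j\<in>UNIV - {c}. B j)"
  proof (intro equalityI subsetI)
    fix \<omega> assume "\<omega> \<in> {\<omega>. (\<forall>l\<le>k. \<omega> l = x l) \<and> (\<forall>l\<in>{Suc k..k + Suc m}. \<omega> l \<noteq> c)}"
    then have hd: "\<forall>l\<le>k. \<omega> l = x l" and tl: "\<And>l. Suc k \<le> l \<Longrightarrow> l \<le> Suc (k + m) \<Longrightarrow> \<omega> l \<noteq> c"
      by auto
    have "\<omega> (Suc k) \<noteq> c" by (rule tl) auto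
    moreover have "\<omega> \<in> B (\<omega> (Suc k))" using hd tl by (auto simp: B_def x'_def le_Suc_eq)
    ultimately show "\<omega> \<in> (\<Union>j\<in>UNIV - {c}. B j)" by blast
  next
    fix \<omega> assume "\<omega> \<in> (\<Union>j\<in>UNIV - {c}. B j)"
    then obtain j where j: "j \<noteq> c" "\<omega> \<in> B j" by auto
    have "\<omega> l \<noteq> c" if "l \<in> {Suc k..k + Suc m}" for l
    proof (cases "l = Suc k")
      case True
      then show ?thesis using j by (auto simp: B_def x'_def)
    next
      case False
      then show ?thesis using j that by (auto simp: B_def)
    qed
    moreover have "\<omega> l = x l" if "l \<le> k" for l
      using j that by (auto simp: B_def x'_def le_Suc_eq)
    ultimately show "\<omega> \<in> {\<omega>. (\<forall>l\<le>k. \<omega> l = x l) \<and> (\<forall>l\<in>{Suc k..k + Suc m}. \<omega> l \<noteq> c)}" by blast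
  qed
  then have "emeasure ?P {\<omega>. (\<forall>l\<le>k. \<omega> l = x l) \<and> (\<forall>l\<in>{Suc k..k + Suc m}. \<omega> l \<noteq> c)} =
      emeasure ?P (\<Union>j\<in>UNIV - {c}. B j)" by simp
  also have "\<dots> = (\<Sum>j\<in>UNIV - {c}. emeasure ?P (B j))"
  proof (rule sum_emeasure[symmetric])
    show "B ` (UNIV - {c}) \<subseteq> sets ?P"
      unfolding B_def using cylinder_avoid_measurable by blast
    have "\<omega> (Suc k) = j" if "\<omega> \<in> B j" for \<omega> j using that by (simp add: B_def x'_def)
    then show "disjoint_family_on B (UNIV - {c})" unfolding disjoint_family_on_def by blast
  qed simp
  also have "\<dots> = E * (\<Sum>j\<in>UNIV - {c}. ennreal (M $ x k $ j * avoid_prob M c m j))"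
    by (simp add: eB sum_distrib_left)
  also have "\<dots> = E * ennreal (avoid_prob M c (Suc m) (x k))"
    using M avoid_prob_nonneg[OF M, of c m]
    by (simp add: taboo_apply_def sum_ennreal markov_matrix_def)
  finally show ?case by (simp add: E_def)
qed simp

lemma emeasure_avoid:
  fixes M :: "real^'n^'n"
  assumes M: "markov_matrix M"
  shows "{\<omega>. \<forall>l\<in>{1..m}. \<omega> l \<noteq> c} \<in> sets (path_measure M i)"
    and "emeasure (path_measure M i) {\<omega>. \<forall>l\<in>{1..m}. \<omega> l \<noteq> c} = ennreal (avoid_prob M c m i)"
proof -
  let ?P = "path_measure M i"
  \<comment> \<open>Split by the state at time 0; all parts but the one for \<open>i\<close> are
    null sets.\<close>
  define B where "B j = {\<omega>. (\<forall>l\<le>0. \<omega> l = j) \<and> (\<forall>l\<in>{Suc 0..0 + m}. \<omega> l \<noteq> c)}" for j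
  have B: "B j \<in> sets ?P" for j
    unfolding B_def by (rule cylinder_avoid_measurable[where x = "\<lambda>_. j"])
  have UB: "{\<omega>. \<forall>l\<in>{1..m}. \<omega> l \<noteq> c} = (\<Union>j\<in>UNIV. B j)" by (auto simp: B_def)
  then show "{\<omega>. \<forall>l\<in>{1..m}. \<omega> l \<noteq> c} \<in> sets ?P" using B by auto
  have "emeasure ?P (\<Union>j\<in>UNIV. B j) = (\<Sum>j\<in>UNIV. emeasure ?P (B j))"
    using B by (intro sum_emeasure[symmetric]) (auto simp: disjoint_family_on_def B_def)
  also have "\<dots> = (\<Sum>j\<in>UNIV. if j = i then ennreal (avoid_prob M c m i) else 0)"
    unfolding B_def emeasure_cylinder_avoid[OF M, where x = "\<lambda>_. _"]
      emeasure_path_measure_cylinder[OF M] by (intro sum.cong) auto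
  finally show "emeasure ?P {\<omega>. \<forall>l\<in>{1..m}. \<omega> l \<noteq> c} = ennreal (avoid_prob M c m i)"
    unfolding UB by simp
qed

text \<open>Pathwise tail formula: T is the sum over k \<ge> 0 of the indicators of T > k. The term
  k = 0 is always 1, because \<open>{1..0}\<close> is empty; if \<open>c\<close> is never hit, both
  sides are infinite.\<close>

lemma hitting_time_eq_suminf:
  "hitting_time c \<omega> = (\<Sum>k. indicator {\<omega>. \<forall>l\<in>{1..k}. \<omega> l \<noteq> c} \<omega>)"
proof (cases "\<exists>k\<ge>1. \<omega> k = c")
  case True
  define m where "m = (LEAST k. 1 \<le> k \<and> \<omega> k = c)"
  have m: "1 \<le> m" "\<omega> m = c" using LeastI_ex[OF True] by (auto simp: m_def)
  have before: "\<omega> k \<noteq> c" if "1 \<le> k" "k < m" for k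
    using not_less_Least[of k "\<lambda>k. 1 \<le> k \<and> \<omega> k = c"] that by (auto simp: m_def)
  have "hitting_time c \<omega> = of_nat m"
    unfolding hitting_time_def
  proof (rule antisym)
    show "(INF k\<in>{k. 1 \<le> k \<and> \<omega> k = c}. of_nat k) \<le> (of_nat m :: ennreal)"
      using m by (intro INF_lower) auto
    show "of_nat m \<le> (INF k\<in>{k. 1 \<le> k \<and> \<omega> k = c}. of_nat k :: ennreal)"
      using before by (intro INF_greatest) (auto simp: not_less[symmetric])
  qed
  also have "\<dots> = (\<Sum>k<m. indicator {\<omega>. \<forall>l\<in>{1..k}. \<omega> l \<noteq> c} \<omega>)"
    using before by simp
  also have "\<dots> = (\<Sum>k. indicator {\<omega>. \<forall>l\<in>{1..k}. \<omega> l \<noteq> c} \<omega>)"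
    using m by (intro suminf_finite[symmetric]) (auto simp: indicator_def not_less)
  finally show ?thesis .
next
  case False
  then have "indicator {\<omega>. \<forall>l\<in>{1..k}. \<omega> l \<noteq> c} \<omega> = (1::ennreal)" for k
    by (auto simp: indicator_def)
  moreover have "hitting_time c \<omega> = \<infinity>"
    using False by (simp add: hitting_time_def)
  moreover have "(\<Sum>k::nat. 1 :: ennreal) = \<infinity>"
    by (simp add: suminf_eq_SUP ennreal_SUP_of_nat_eq_top)
  ultimately show ?thesis by simp
qed

lemma expected_hitting_time_eq_suminf:
  fixes M :: "real^'n^'n"
  assumes M: "markov_matrix M"
  shows "expected_hitting_time M i c = (\<Sum>k. ennreal (avoid_prob M c k i))"
proof -
  have "expected_hitting_time M i c =
      (\<integral>\<^sup>+\<omega>. (\<Sum>k. indicator {\<omega>. \<forall>l\<in>{1..k}. \<omega> l \<noteq> c} \<omega>) \<partial>path_measure M i)"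
    by (simp add: expected_hitting_time_def hitting_time_eq_suminf)
  also have "\<dots> = (\<Sum>k. \<integral>\<^sup>+\<omega>. indicator {\<omega>. \<forall>l\<in>{1..k}. \<omega> l \<noteq> c} \<omega> \<partial>path_measure M i)"
    using emeasure_avoid(1)[OF M] by (intro nn_integral_suminf) auto
  also have "\<dots> = (\<Sum>k. ennreal (avoid_prob M c k i))"
    using emeasure_avoid[OF M] by simp
  finally show ?thesis .
qed

text \<open>By the maximum principle for y and -y, identity minus killed matrix is injective, hence
  surjective in finite dimension. The solution serves as an a priori bound on expected hitting
  times, so no decay estimate is needed.\<close>

lemma taboo_equation_solvable:
  fixes M :: "real^'n^'n"
  assumes M: "markov_matrix M" and reach: "\<And>i. (i, c) \<in> (transition_rel M)\<^sup>*"
  shows "\<exists>t. \<forall>i. 0 \<le> t i \<and> t i = 1 + taboo_apply M c t i"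
proof -
  define L where "L y = (\<chi> i. y $ i - taboo_apply M c (($) y) i)" for y :: "real^'n"
  have lin: "linear L"
    by (rule linearI) (auto simp: L_def taboo_apply_def vec_eq_iff algebra_simps sum.distrib sum_distrib_left)
  have "inj L"
  proof (rule linear_injective_0[OF lin, THEN iffD2], intro allI impI)
    fix y assume "L y = 0"
    then have y: "y $ i = taboo_apply M c (($) y) i" for i by (simp add: L_def vec_eq_iff)
    have "y $ i \<le> 0" for i
      by (rule taboo_maximum_principle[OF M reach eq_refl]) (rule y)
    moreover have "- y $ i \<le> 0" for i
      by (rule taboo_maximum_principle[OF M reach, where y = "\<lambda>i. - y $ i"])
        (simp add: taboo_apply_minus y[symmetric])
    ultimately show "y = 0" by (simp add: vec_eq_iff antisym)
  qed
  then have "surj L" by (rule linear_inj_imp_surj[OF lin])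
  then obtain t where "L t = 1" by (metis surjD)
  then have t: "t $ i = 1 + taboo_apply M c (($) t) i" for i
    by (simp add: L_def vec_eq_iff algebra_simps)
  have "- t $ i \<le> 0" for i
  proof (rule taboo_maximum_principle[OF M reach, where y = "\<lambda>i. - t $ i"])
    show "- t $ i \<le> taboo_apply M c (\<lambda>i. - t $ i) i" for i
      using t[of i] by (simp add: taboo_apply_minus)
  qed
  then have "0 \<le> t $ i" for i by simp
  with t show ?thesis by blast
qed

lemma expected_hitting_time_equation:
  fixes M :: "real^'n^'n"
  assumes M: "markov_matrix M" and reach: "\<And>i. (i, c) \<in> (transition_rel M)\<^sup>*"
  shows "\<exists>t. \<forall>i. 0 \<le> t i \<and> t i = 1 + taboo_apply M c t i \<and>
    expected_hitting_time M i c = ennreal (t i)"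
proof -
  obtain u where u: "\<And>i. 0 \<le> u i" "\<And>i. u i = 1 + taboo_apply M c u i"
    using taboo_equation_solvable[OF assms] by blast
  \<comment> \<open>The partial sums arise from 0 by iterating y \<mapsto> 1 +
    \<open>taboo_apply M c y\<close>, which is monotone, so they stay below the nonnegative solution
    \<open>u\<close>. Their limit then solves the equation too.\<close>
  have partial: "(\<Sum>k<m. avoid_prob M c k i) \<le> u i" for m i
  proof (induction m arbitrary: i)
    case (Suc m)
    have "(\<Sum>k<Suc m. avoid_prob M c k i) = 1 + (\<Sum>k<m. taboo_apply M c (avoid_prob M c k) i)"
      by (subst sum.lessThan_Suc_shift) simp
    also have "\<dots> = 1 + taboo_apply M c (\<lambda>j. \<Sum>k<m. avoid_prob M c k j) i"
      unfolding taboo_apply_def sum_distrib_left by (subst sum.swap) simp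
    also have "\<dots> \<le> u i" using u(2)[of i] taboo_apply_mono[OF M Suc.IH] by simp
    finally show ?case .
  qed (use u in simp)
  have sm: "summable (\<lambda>k. avoid_prob M c k i)" for i
    using avoid_prob_nonneg[OF M] partial by (rule summableI_nonneg_bounded)
  define t where "t i = (\<Sum>k. avoid_prob M c k i)" for i
  have "t i = 1 + taboo_apply M c t i" for i
  proof -
    have "t i = 1 + (\<Sum>k. taboo_apply M c (avoid_prob M c k) i)"
      using suminf_split_head[OF sm[of i]] by (simp add: t_def)
    also have "(\<Sum>k. taboo_apply M c (avoid_prob M c k) i) = taboo_apply M c t i"
      unfolding taboo_apply_def t_def
      by (subst suminf_sum) (auto intro: summable_mult sm simp: suminf_mult[OF sm])
    finally show ?thesis .
  qed
  moreover have "0 \<le> t i" for i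
    using avoid_prob_nonneg[OF M] by (simp add: t_def suminf_nonneg sm)
  moreover have "expected_hitting_time M i c = ennreal (t i)" for i
    unfolding expected_hitting_time_eq_suminf[OF M] t_def
    using avoid_prob_nonneg[OF M] sm by (intro suminf_ennreal2) auto
  ultimately show ?thesis by blast
qed

text \<open>
  A matrix whose hitting times have maximal sum is optimal at all states at once: by
  rectangularity, a row that violated the inequality could be exchanged, which would increase
  the sum.
\<close>
lemma max_hitting_time_supersolution:
  fixes \<M> :: "(real^'n^'n) set"
  assumes fin: "finite \<M>" "\<M> \<noteq> {}"
    and markov: "\<And>M. M \<in> \<M> \<Longrightarrow> markov_matrix M"
    and reach: "\<And>M i. M \<in> \<M> \<Longrightarrow> (i, c) \<in> (transition_rel M)\<^sup>*"
    and rect: "\<And>M M' i. M \<in> \<M> \<Longrightarrow> M' \<in> \<M> \<Longrightarrow> (\<chi> k. if k = i then M' $ k else M $ k) \<in> \<M>"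
  shows "\<exists>\<phi>. (\<forall>i. 1 \<le> \<phi> i \<and> max_hitting_time \<M> i c = ennreal (\<phi> i)) \<and>
    (\<forall>M\<in>\<M>. \<forall>i. 1 + taboo_apply M c \<phi> i \<le> \<phi> i)"
proof -
  have "\<forall>M\<in>\<M>. \<exists>t. \<forall>i. 0 \<le> t i \<and> t i = 1 + taboo_apply M c t i \<and>
      expected_hitting_time M i c = ennreal (t i)"
    using expected_hitting_time_equation[OF markov reach] by blast
  then obtain t where t: "\<And>M i. M \<in> \<M> \<Longrightarrow> 0 \<le> t M i"
    "\<And>M i. M \<in> \<M> \<Longrightarrow> t M i = 1 + taboo_apply M c (t M) i"
    "\<And>M i. M \<in> \<M> \<Longrightarrow> expected_hitting_time M i c = ennreal (t M i)"
    by metis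
  define W where "W M = (\<Sum>i\<in>UNIV. t M i)" for M
  have "Max (W ` \<M>) \<in> W ` \<M>" using fin by (intro Max_in) auto
  then obtain N where N: "N \<in> \<M>" "Max (W ` \<M>) = W N" by (rule imageE) blast
  have W_le: "W M \<le> W N" if "M \<in> \<M>" for M using N(2) fin that by (metis Max_ge finite_imageI imageI)
  have super: "1 + taboo_apply M c (t N) i \<le> t N i" if M: "M \<in> \<M>" for M i
  proof (rule ccontr)
    assume "\<not> ?thesis"
    then have viol: "t N i < 1 + taboo_apply M c (t N) i" by simp
    define M' where "M' = (\<chi> k. if k = i then M $ k else N $ k)"
    have M': "M' \<in> \<M>" unfolding M'_def by (rule rect[OF N(1) M])
    have row: "taboo_apply M' c y k = taboo_apply (if k = i then M else N) c y k" for y k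
      by (simp add: taboo_apply_def M'_def)
    \<comment> \<open>After the exchange \<open>t N\<close> is a subsolution for \<open>M'\<close>,
      strict at \<open>i\<close>; the maximum principle puts it below \<open>t M'\<close>.\<close>
    have sub: "t N k \<le> 1 + taboo_apply M' c (t N) k" for k
      using viol t(2)[OF N(1), of k] by (auto simp: row)
    have "t N k - t M' k \<le> 0" for k
    proof (rule taboo_maximum_principle[OF markov[OF M'] reach[OF M'], where y = "\<lambda>k. t N k - t M' k"])
      show "t N k - t M' k \<le> taboo_apply M' c (\<lambda>k. t N k - t M' k) k" for k
        using sub[of k] t(2)[OF M', of k] by (simp add: taboo_apply_diff)
    qed
    then have le: "t N k \<le> t M' k" for k by simp
    have "t N i < 1 + taboo_apply M' c (t N) i" using viol by (simp add: row)
    also have "\<dots> \<le> 1 + taboo_apply M' c (t M') i"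
      using taboo_apply_mono[OF markov[OF M'] le] by simp
    also have "\<dots> = t M' i" using t(2)[OF M'] by simp
    finally have "W N < W M'" unfolding W_def using le by (intro sum_strict_mono_ex1) auto
    with W_le[OF M'] show False by simp
  qed
  have le: "t M i \<le> t N i" if M: "M \<in> \<M>" for M i
  proof -
    have "t M i - t N i \<le> 0"
    proof (rule taboo_maximum_principle[OF markov[OF M] reach[OF M], where y = "\<lambda>k. t M k - t N k"])
      show "t M k - t N k \<le> taboo_apply M c (\<lambda>k. t M k - t N k) k" for k
        using super[OF M, of k] t(2)[OF M, of k] by (simp add: taboo_apply_diff)
    qed
    then show ?thesis by simp
  qed
  have "max_hitting_time \<M> i c = ennreal (t N i)" for i
    unfolding max_hitting_time_def
  proof (rule Max_eqI)
    show "ennreal (t N i) \<in> (\<lambda>M. expected_hitting_time M i c) ` \<M>"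
      using N(1) t(3) by force
  qed (use fin t(3) le in \<open>auto intro: ennreal_leI\<close>)
  moreover have "1 \<le> t N i" for i
  proof -
    have "0 \<le> taboo_apply N c (t N) i"
      using t(1)[OF N(1)] markov[OF N(1)] unfolding taboo_apply_def
      by (intro sum_nonneg) (auto simp: markov_matrix_def)
    then show ?thesis using t(2)[OF N(1), of i] by simp
  qed
  ultimately show ?thesis using super by (intro exI[of _ "t N"]) auto
qed

section \<open>Polyhedral maps\<close>

text \<open>
  The first piece is left for good at its last point; by closedness the other pieces
  still cover that point.
\<close>
lemma antimono_on_closed_cover:
  fixes g :: "real \<Rightarrow> real"
  assumes "finite \<I>" "\<And>I. I \<in> \<I> \<Longrightarrow> closed I"
    and "\<And>I s t. I \<in> \<I> \<Longrightarrow> s \<in> I \<Longrightarrow> t \<in> I \<Longrightarrow> s \<le> t \<Longrightarrow> g t \<le> g s"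
    and "a \<le> b" "{a..b} \<subseteq> \<Union>\<I>"
  shows "g b \<le> g a"
  using assms
proof (induction \<I> arbitrary: a rule: finite_psubset_induct)
  case (psubset \<I>)
  obtain I where I: "I \<in> \<I>" "a \<in> I" using psubset.prems(3,4) by force
  have "compact (I \<inter> {a..b})" using psubset.prems(1)[OF I(1)] by (intro closed_Int_compact) auto
  moreover have "I \<inter> {a..b} \<noteq> {}" using I psubset.prems(3) by auto
  ultimately obtain m where "m \<in> I \<inter> {a..b}" and m_max: "\<forall>t\<in>I \<inter> {a..b}. t \<le> m"
    using compact_attains_sup[of "I \<inter> {a..b}"] by blast
  then have m: "m \<in> I" "a \<le> m" "m \<le> b" by auto
  have "g m \<le> g a" using psubset.prems(2) I m by blast
  moreover have "g b \<le> g m"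
  proof (cases "m = b")
    case False
    have "{m<..b} \<subseteq> \<Union>(\<I> - {I})"
    proof
      fix t assume t: "t \<in> {m<..b}"
      with m have "t \<in> {a..b}" by auto
      with psubset.prems(4) obtain J where "J \<in> \<I>" "t \<in> J" by blast
      moreover have "t \<notin> I" using m_max t m by force
      ultimately show "t \<in> \<Union>(\<I> - {I})" by blast
    qed
    moreover have "closed (\<Union>(\<I> - {I}))"
      using psubset by (intro closed_Union) auto
    ultimately have "closure {m<..b} \<subseteq> \<Union>(\<I> - {I})" by (rule closure_minimal)
    then have "{m..b} \<subseteq> \<Union>(\<I> - {I})" using False m by simp
    then show ?thesis using psubset.prems I m by (intro psubset.IH) auto
  qed simp
  ultimately show ?case by simp
qed

text \<open>Along the segment from \<open>w\<close> to \<open>v\<close>, the i-th coordinate of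
  \<open>g\<close> is affine on each piece, with slope (N_P (v - w))_i. Subtracting the line of
  largest slope leaves a function that is nonincreasing on every piece. The matrix depends on
  \<open>i\<close>.\<close>

lemma polyhedral_mean_value:
  fixes g :: "real^'n \<Rightarrow> real^'n"
  assumes "polyhedral_map g"
  shows "\<exists>N\<in>imD g. g v $ i - g w $ i \<le> (N *v (v - w)) $ i"
proof -
  obtain \<P> where \<P>: "polyhedral_cover g \<P>" using assms by (auto simp: polyhedral_map_def)
  then have fin: "finite \<P>" and cover: "\<Union>\<P> = UNIV"
    and poly: "\<And>P. P \<in> \<P> \<Longrightarrow> polyhedron P" by (auto simp: polyhedral_cover_def)
  have "\<forall>P\<in>\<P>. \<exists>N b. \<forall>x\<in>P. g x = N *v x + b"
    using \<P> by (auto simp: polyhedral_cover_def affine_with_matrix_on_def)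
  then obtain N b where N: "\<And>P x. P \<in> \<P> \<Longrightarrow> x \<in> P \<Longrightarrow> g x = N P *v x + b P" by metis
  define slope where "slope P = (N P *v (v - w)) $ i" for P
  have "Max (slope ` \<P>) \<in> slope ` \<P>" using fin cover by (intro Max_in) auto
  then obtain Q where Q: "Q \<in> \<P>" "Max (slope ` \<P>) = slope Q" by (rule imageE) blast
  have slope_le: "slope P \<le> slope Q" if "P \<in> \<P>" for P
    using Q(2) fin that by (metis Max_ge finite_imageI imageI)
  define l where "l t = w + t *\<^sub>R (v - w)" for t
  define h where "h t = g (l t) $ i - t * slope Q" for t
  have h: "h t = (N P *v w) $ i + b P $ i + t * (slope P - slope Q)" if "P \<in> \<P>" "l t \<in> P" for P t
  proof -
    have "g (l t) $ i = (N P *v l t) $ i + b P $ i" using N[OF that] by simp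
    also have "(N P *v l t) $ i = (N P *v w) $ i + t * slope P"
      by (simp add: l_def slope_def matrix_vector_right_distrib matrix_vector_mult_scaleR)
    finally show ?thesis by (simp add: h_def algebra_simps)
  qed
  have "h 1 \<le> h 0"
  proof (rule antimono_on_closed_cover[where g = h and a = 0 and b = 1 and \<I> = "(\<lambda>P. l -` P) ` \<P>"])
    show "closed I" if I: "I \<in> (\<lambda>P. l -` P) ` \<P>" for I
    proof -
      have "continuous_on UNIV l" unfolding l_def by (intro continuous_intros)
      moreover obtain P where "P \<in> \<P>" "I = l -` P" using I by blast
      ultimately show ?thesis using closed_vimage polyhedron_imp_closed poly by blast
    qed
    show "h t \<le> h s" if I: "I \<in> (\<lambda>P. l -` P) ` \<P>" "s \<in> I" "t \<in> I" and "s \<le> t" for I s t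
    proof -
      obtain P where P: "P \<in> \<P>" "l s \<in> P" "l t \<in> P" using I by auto
      have "t * (slope P - slope Q) \<le> s * (slope P - slope Q)"
        using slope_le[OF P(1)] \<open>s \<le> t\<close> by (intro mult_right_mono_neg) auto
      then show ?thesis using h P by simp
    qed
    show "{0..1} \<subseteq> \<Union>((\<lambda>P. l -` P) ` \<P>)" unfolding vimage_Union[symmetric] cover by simp
  qed (use fin in auto)
  then have "g v $ i - g w $ i \<le> slope Q" by (simp add: h_def l_def)
  moreover have "N Q \<in> imD g"
    using imD_cover[OF \<P>] Q(1) N by (auto simp: affine_with_matrix_on_def)
  ultimately show ?thesis by (auto simp: slope_def)
qed

lemma finite_imD:
  fixes g :: "real^'n \<Rightarrow> real^'n"
  assumes "polyhedral_map g"
  shows "finite (imD g)"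
proof -
  obtain \<P> where \<P>: "polyhedral_cover g \<P>" using assms by (auto simp: polyhedral_map_def)
  have "finite {N. affine_with_matrix_on g P N}" if P: "P \<in> \<P>" for P
  proof -
    obtain N where "affine_with_matrix_on g P N" "interior P \<noteq> {}"
      using \<P> P unfolding polyhedral_cover_def by blast
    then have "N' = N" if "affine_with_matrix_on g P N'" for N'
      using affine_with_matrix_on_unique[OF that, of P N] by simp
    then have "{N. affine_with_matrix_on g P N} \<subseteq> {N}" by blast
    then show ?thesis by (rule finite_subset) simp
  qed
  moreover have "imD g = (\<Union>P\<in>\<P>. {N. affine_with_matrix_on g P N})"
    using imD_cover[OF \<P>] by auto
  ultimately show ?thesis using \<P> by (simp add: polyhedral_cover_def)
qed

lemma imD_nonempty:
  fixes g :: "real^'n \<Rightarrow> real^'n"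
  assumes "polyhedral_map g"
  shows "imD g \<noteq> {}"
  using polyhedral_mean_value[OF assms] by blast

lemma row_eq_nth: "row i N = N $ i"
  by (simp add: row_def)

lemma finite_rectangular_hull:
  fixes \<N> :: "(real^'n^'n) set"
  assumes "finite \<N>"
  shows "finite (rectangular_hull \<N>)"
proof (rule finite_subset)
  show "rectangular_hull \<N> \<subseteq> (\<lambda>h. \<chi> i. h i $ i) ` (PiE UNIV (\<lambda>_. \<N>))"
  proof
    fix N assume "N \<in> rectangular_hull \<N>"
    then have "\<forall>i. \<exists>N'\<in>\<N>. N $ i = N' $ i" by (simp add: rectangular_hull_def row_eq_nth)
    then obtain h where h: "\<And>i. h i \<in> \<N>" "\<And>i. N $ i = h i $ i" by metis
    then have "N = (\<chi> i. h i $ i)" by (simp add: vec_eq_iff)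
    then show "N \<in> (\<lambda>h. \<chi> i. h i $ i) ` (PiE UNIV (\<lambda>_. \<N>))" using h(1) by (intro image_eqI) auto
  qed
qed (intro finite_imageI finite_PiE finite assms)

text \<open>Near an interior point of its piece, \<open>N\<close> can be read off from small
  displacements: along basis vectors, order preservation gives nonnegative entries; along the
  all-ones vector, homogeneity gives row sums 1.\<close>

lemma markov_matrix_imD:
  fixes g :: "real^'n \<Rightarrow> real^'n"
  assumes hom: "additively_homogeneous g" and mono: "mono g" and N: "N \<in> imD g"
  shows "markov_matrix N"
proof -
  obtain P where P: "interior P \<noteq> {}" "affine_with_matrix_on g P N"
    using N unfolding imD_def polyhedral_cover_def by blast
  then obtain x b where x: "x \<in> interior P" and b: "\<And>y. y \<in> P \<Longrightarrow> g y = N *v y + b"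
    by (auto simp: affine_with_matrix_on_def)
  obtain e where e: "e > 0" "ball x e \<subseteq> P" using x by (auto simp: mem_interior)
  have diff: "\<exists>t>0. g (x + t *\<^sub>R u) - g x = t *\<^sub>R (N *v u)" for u
  proof -
    \<comment> \<open>This keeps t |u| below e; the summand 1 avoids a division by zero at u =
      0.\<close>
    define t where "t = e / (2 * (norm u + 1))"
    have t: "t > 0" using e by (simp add: t_def add_nonneg_pos)
    have "norm u + 1 > 0" by (simp add: add_nonneg_pos)
    then have "t * (norm u + 1) = e / 2" by (simp add: t_def field_simps)
    then have "t * norm u < e" using t e by (simp add: algebra_simps)
    then have "x + t *\<^sub>R u \<in> P" using t e by (intro subsetD[OF e(2)]) (simp add: dist_norm)
    moreover have "x \<in> P" using e by auto
    ultimately have "g (x + t *\<^sub>R u) - g x = t *\<^sub>R (N *v u)"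
      using b by (simp add: matrix_vector_right_distrib matrix_vector_mult_scaleR)
    with t show ?thesis by blast
  qed
  have "0 \<le> N $ i $ j" for i j
  proof -
    obtain t where t: "t > 0" "g (x + t *\<^sub>R axis j 1) - g x = t *\<^sub>R (N *v axis j 1)"
      using diff by blast
    have "x \<le> x + t *\<^sub>R axis j 1" using t(1) by (simp add: less_eq_vec_def axis_def)
    from monoD[OF mono this] have "g x $ i \<le> g (x + t *\<^sub>R axis j 1) $ i"
      by (simp add: less_eq_vec_def)
    also have "\<dots> = g x $ i + t * (N *v axis j 1) $ i"
      using arg_cong[OF t(2), of "\<lambda>y. y $ i"] by simp
    finally show ?thesis using t(1) by (simp add: matrix_vector_mult_basis column_def zero_le_mult_iff)
  qed
  moreover have "(\<Sum>j\<in>UNIV. N $ i $ j) = 1" for i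
  proof -
    obtain t where t: "t > 0" "g (x + t *\<^sub>R vec 1) - g x = t *\<^sub>R (N *v vec 1)"
      using diff by blast
    have "x + t *\<^sub>R vec 1 = vec t + x" by (simp add: vec_eq_iff)
    then have "g (x + t *\<^sub>R vec 1) = vec t + g x" using hom by (metis additively_homogeneous_def)
    then have "t * (N *v vec 1) $ i = t" using arg_cong[OF t(2), of "\<lambda>y. y $ i"] by simp
    then show ?thesis using t(1) by (simp add: matrix_vector_mult_def)
  qed
  ultimately show ?thesis by (simp add: markov_matrix_def)
qed

text \<open>
  Both maps have the same $k$-th coordinate; the map all of whose coordinates are this one is
  affine on the pieces of either cover.
\<close>
lemma imD_row_transfer:
  fixes g h :: "real^'n \<Rightarrow> real^'n"
  assumes g: "polyhedral_map g" and h: "polyhedral_map h"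
    and eq: "\<And>v. g v $ k = h v $ k" and N: "N \<in> imD g"
  shows "\<exists>N'\<in>imD h. N $ k = N' $ k"
proof -
  define diag where "diag f x = ((\<chi> j. f x $ k) :: real^'n)" for f :: "real^'n \<Rightarrow> real^'n" and x :: "real^'n"
  have diag: "affine_with_matrix_on (diag f) P (\<chi> j. N $ k)"
    if aff: "affine_with_matrix_on f P N" for f P and N :: "real^'n^'n"
  proof -
    obtain b where "\<forall>x\<in>P. f x = N *v x + b" using aff by (auto simp: affine_with_matrix_on_def)
    then have "\<forall>x\<in>P. diag f x = (\<chi> j. N $ k) *v x + (\<chi> j. b $ k)"
      by (simp add: diag_def vec_eq_iff matrix_vector_mult_def)
    then show ?thesis by (auto simp: affine_with_matrix_on_def)
  qed
  have diag_cover: "polyhedral_cover (diag f) \<P>" if "polyhedral_cover f \<P>" for f \<P>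
    using that diag unfolding polyhedral_cover_def by blast
  obtain \<P> where \<P>: "polyhedral_cover g \<P>" using g by (auto simp: polyhedral_map_def)
  obtain \<Q> where \<Q>: "polyhedral_cover h \<Q>" using h by (auto simp: polyhedral_map_def)
  have same: "diag g = diag h" by (simp add: diag_def eq fun_eq_iff)
  have "(\<chi> j. N $ k) \<in> imD (diag g)"
    using N diag unfolding imD_cover[OF \<P>] imD_cover[OF diag_cover[OF \<P>]] by blast
  then obtain Q where Q: "Q \<in> \<Q>" "affine_with_matrix_on (diag h) Q (\<chi> j. N $ k)"
    unfolding same imD_cover[OF diag_cover[OF \<Q>]] by blast
  then obtain N' where N': "affine_with_matrix_on h Q N'" and Qi: "interior (Q \<inter> Q) \<noteq> {}"
    using \<Q> by (auto simp: polyhedral_cover_def)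
  have "((\<chi> j. N' $ k) :: real^'n^'n) = (\<chi> j. N $ k)"
    by (rule affine_with_matrix_on_unique[OF diag[OF N'] Q(2) Qi])
  then have "N $ k = N' $ k" by (simp add: vec_eq_iff)
  moreover have "N' \<in> imD h" using N' Q(1) imD_cover[OF \<Q>] by blast
  ultimately show ?thesis by blast
qed

section \<open>Reduction to the discounted problem\<close>

text \<open>With d = x - y, the mean value inequality and the supersolution property bound the
  change of the i-th coordinate by (\<phi>_i - 1)(\<alpha> - d_c). The added term (\<phi>_i - 1) x_c
  cancels d_c, and division by \<phi>_i leaves the rate 1 - 1/\<phi>_i \<le> 1 - 1/K.\<close>

lemma discounted_rescaled:
  fixes g :: "real^'n \<Rightarrow> real^'n"
  assumes g: "polyhedral_map g" and markov: "\<And>N. N \<in> imD g \<Longrightarrow> markov_matrix N"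
    and \<phi>: "\<And>i. 1 \<le> \<phi> i" "\<And>i. \<phi> i \<le> K"
    and super: "\<And>N i. N \<in> imD g \<Longrightarrow> 1 + taboo_apply N c \<phi> i \<le> \<phi> i"
  shows "discounted ((K - 1) / K)
    (\<lambda>x i. (g (\<chi> j. \<phi> j * (x j - x c)) $ i + (\<phi> i - 1) * x c) / \<phi> i)"
  unfolding discounted_def
proof (intro allI impI)
  fix x y :: "'n \<Rightarrow> real" and \<alpha> :: real and i
  assume \<alpha>: "0 \<le> \<alpha>" and xy: "\<forall>j. x j \<le> y j + \<alpha>"
  define V where "V x = (\<chi> j. \<phi> j * (x j - x c))" for x :: "'n \<Rightarrow> real"
  define d where "d j = x j - y j" for j
  have d: "d j \<le> \<alpha>" for j using xy by (simp add: d_def algebra_simps)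
  have pos: "0 < \<phi> i" using \<phi>(1)[of i] by simp
  obtain N where N: "N \<in> imD g" "g (V x) $ i - g (V y) $ i \<le> (N *v (V x - V y)) $ i"
    using polyhedral_mean_value[OF g] by blast
  have "(N *v (V x - V y)) $ i = (\<Sum>j\<in>UNIV. N $ i $ j * (\<phi> j * (d j - d c)))"
    by (simp add: matrix_vector_mult_def V_def d_def algebra_simps)
  \<comment> \<open>The term j = c vanishes, as d_c - d_c = 0: normalising at \<open>c\<close> is
    what deletes its column.\<close>
  also have "\<dots> = taboo_apply N c (\<lambda>j. \<phi> j * (d j - d c)) i"
    unfolding taboo_apply_def by (rule sum.mono_neutral_cong_right) auto
  also have "\<dots> \<le> taboo_apply N c (\<lambda>j. \<phi> j * (\<alpha> - d c)) i"
  proof (rule taboo_apply_mono[OF markov[OF N(1)]])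
    show "\<phi> j * (d j - d c) \<le> \<phi> j * (\<alpha> - d c)" for j
      using d[of j] \<phi>(1)[of j] by (intro mult_left_mono) auto
  qed
  also have "\<dots> = taboo_apply N c \<phi> i * (\<alpha> - d c)"
    by (simp add: taboo_apply_def sum_distrib_right mult.assoc)
  also have "\<dots> \<le> (\<phi> i - 1) * (\<alpha> - d c)"
    using super[OF N(1), of i] d[of c] by (intro mult_right_mono) auto
  finally have "g (V x) $ i + (\<phi> i - 1) * x c \<le> g (V y) $ i + (\<phi> i - 1) * y c + (\<phi> i - 1) * \<alpha>"
    using N(2) by (simp add: d_def algebra_simps)
  then have "(g (V x) $ i + (\<phi> i - 1) * x c) / \<phi> i
      \<le> (g (V y) $ i + (\<phi> i - 1) * y c + (\<phi> i - 1) * \<alpha>) / \<phi> i"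
    using pos by (intro divide_right_mono) auto
  also have "\<dots> = (g (V y) $ i + (\<phi> i - 1) * y c) / \<phi> i + (\<phi> i - 1) / \<phi> i * \<alpha>"
    by (simp add: add_divide_distrib)
  also have "(\<phi> i - 1) / \<phi> i * \<alpha> \<le> (K - 1) / K * \<alpha>"
  proof (intro mult_right_mono \<alpha>)
    show "(\<phi> i - 1) / \<phi> i \<le> (K - 1) / K"
      using pos \<phi>(2)[of i] by (simp add: field_simps)
  qed
  finally show "(g (\<chi> j. \<phi> j * (x j - x c)) $ i + (\<phi> i - 1) * x c) / \<phi> i
      \<le> (g (\<chi> j. \<phi> j * (y j - y c)) $ i + (\<phi> i - 1) * y c) / \<phi> i + (K - 1) / K * \<alpha>"
    unfolding V_def by simp
qed

lemma fixpoint_imp_eigenpair: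
  assumes \<phi>: "\<And>i. 1 \<le> \<phi> i"
    and x: "\<And>i. (g (\<chi> j. \<phi> j * (x j - x c)) $ i + (\<phi> i - 1) * x c) / \<phi> i = x i"
  shows "solves_eigenproblem g c (x c) (\<chi> j. \<phi> j * (x j - x c))"
proof -
  have "x c + \<phi> i * (x i - x c) = g (\<chi> j. \<phi> j * (x j - x c)) $ i" for i
  proof -
    have "\<phi> i \<noteq> 0" using \<phi>[of i] by auto
    then show ?thesis using x[of i] by (simp add: divide_eq_eq algebra_simps)
  qed
  then show ?thesis by (simp add: solves_eigenproblem_def vec_eq_iff)
qed

text \<open>The substitution inverted: v_c = 0 gives x_c = \<eta>. This carries the eigenpairs met
  in a run over to value vectors, whereas the opposite direction supplies the solution that each
  evaluation needs.\<close>

lemma eigenpair_imp_fixpoint: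
  assumes \<phi>: "\<And>i. 1 \<le> \<phi> i" and v: "solves_eigenproblem g c \<eta> v"
    and x: "\<And>i. x i = v $ i / \<phi> i + \<eta>"
  shows "(\<chi> j. \<phi> j * (x j - x c)) = v" "x c = \<eta>"
    and "(g v $ i + (\<phi> i - 1) * \<eta>) / \<phi> i = x i"
proof -
  have \<phi>0: "\<phi> j \<noteq> 0" for j using \<phi>[of j] by auto
  have g: "\<eta> + v $ j = g v $ j" for j
    using v by (simp add: solves_eigenproblem_def vec_eq_iff)
  show "x c = \<eta>" using v by (simp add: x solves_eigenproblem_def)
  then show "(\<chi> j. \<phi> j * (x j - x c)) = v" using \<phi>0 by (simp add: x vec_eq_iff)
  show "(g v $ i + (\<phi> i - 1) * \<eta>) / \<phi> i = x i"
    using \<phi>0[of i] by (simp add: x g[symmetric] field_simps)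
qed

section \<open>From the transition system to sequences of policies\<close>

lemma pi_stops_withinI:
  assumes solvable: "\<And>\<sigma>. \<sigma> \<in> AM \<Longrightarrow> \<exists>\<eta> v. solves_eigenproblem (fp \<sigma>) c \<eta> v"
    and improvable: "\<And>\<sigma> v. \<sigma> \<in> AM \<Longrightarrow> \<exists>\<sigma>'. improved_policy AM f fp \<sigma> v \<sigma>'"
    and length: "\<And>\<tau> \<eta> v s. (\<And>t. t \<le> s \<Longrightarrow> \<tau> t \<in> AM) \<Longrightarrow>
      (\<And>t. t < s \<Longrightarrow> solves_eigenproblem (fp (\<tau> t)) c (\<eta> t) (v t)) \<Longrightarrow>
      (\<And>t. t < s \<Longrightarrow> improved_policy AM f fp (\<tau> t) (v t) (\<tau> (Suc t))) \<Longrightarrow>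
      (\<And>t. t < s \<Longrightarrow> \<tau> (Suc t) \<noteq> \<tau> t) \<Longrightarrow> s \<le> N"
  shows "pi_stops_within AM f fp c (int N)"
proof -
  \<comment> \<open>What a run has done on reaching iteration \<open>s\<close>, as plain sequences.
    Eigenpairs are recorded for t < s only: at the start of iteration \<open>s\<close> its own is
    not yet computed.\<close>
  define hist where "hist s \<sigma> \<longleftrightarrow> (\<exists>\<tau> \<eta> v. \<tau> s = \<sigma> \<and> (\<forall>t\<le>s. \<tau> t \<in> AM) \<and>
      (\<forall>t<s. solves_eigenproblem (fp (\<tau> t)) c (\<eta> t) (v t) \<and>
        improved_policy AM f fp (\<tau> t) (v t) (\<tau> (Suc t)) \<and> \<tau> (Suc t) \<noteq> \<tau> t))" for s \<sigma>
  have hist_0: "hist 0 \<sigma>" if "\<sigma> \<in> AM" for \<sigma>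
    unfolding hist_def using that by (intro exI[of _ "\<lambda>_. \<sigma>"]) auto
  have hist_AM: "\<sigma> \<in> AM" if "hist s \<sigma>" for s \<sigma> using that by (auto simp: hist_def)
  have hist_le: "s \<le> N" if h: "hist s \<sigma>" for s \<sigma>
  proof -
    obtain \<tau> \<eta> v where "\<forall>t\<le>s. \<tau> t \<in> AM"
      "\<forall>t<s. solves_eigenproblem (fp (\<tau> t)) c (\<eta> t) (v t) \<and>
        improved_policy AM f fp (\<tau> t) (v t) (\<tau> (Suc t)) \<and> \<tau> (Suc t) \<noteq> \<tau> t"
      using h unfolding hist_def by blast
    then show ?thesis by (intro length[of s \<tau> \<eta> v]) auto
  qed
  have hist_Suc: "hist (Suc s) \<sigma>'"
    if h: "hist s \<sigma>" and sol: "solves_eigenproblem (fp \<sigma>) c \<eta>' v'"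
      and imp: "improved_policy AM f fp \<sigma> v' \<sigma>'" "\<sigma>' \<noteq> \<sigma>" for s \<sigma> \<sigma>' \<eta>' v'
  proof -
    obtain \<tau> \<eta> v where \<tau>: "\<tau> s = \<sigma>" "\<forall>t\<le>s. \<tau> t \<in> AM"
      "\<forall>t<s. solves_eigenproblem (fp (\<tau> t)) c (\<eta> t) (v t) \<and>
        improved_policy AM f fp (\<tau> t) (v t) (\<tau> (Suc t)) \<and> \<tau> (Suc t) \<noteq> \<tau> t"
      using h unfolding hist_def by blast
    have "\<sigma>' \<in> AM" using imp by (simp add: improved_policy_def)
    then show ?thesis
      unfolding hist_def using \<tau> sol imp
      by (intro exI[of _ "\<tau>(Suc s := \<sigma>')"] exI[of _ "\<eta>(s := \<eta>')"] exI[of _ "v(s := v')"])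
        (auto simp: less_Suc_eq le_Suc_eq)
  qed
  define inv where "inv x = (case x of Evaluate s \<sigma> \<Rightarrow> hist s \<sigma>
      | Improve s \<sigma> \<eta> v \<Rightarrow> hist s \<sigma> \<and> solves_eigenproblem (fp \<sigma>) c \<eta> v
      | Stopped s \<sigma> \<eta> v \<Rightarrow> hist s \<sigma>)" for x
  have inv_step: "inv y" if "pi_step AM f fp c x y" "inv x" for x y
    using that by cases (auto simp: inv_def intro: hist_Suc)
  \<comment> \<open>Counts the steps taken since \<open>Evaluate 0\<close>. With s \<le> N it is at
    most 2 N + 2, so no run is infinite.\<close>
  define clock where "clock x = (case x of Evaluate s \<sigma> \<Rightarrow> 2 * s
      | Improve s \<sigma> \<eta> v \<Rightarrow> 2 * s + 1 | Stopped s \<sigma> \<eta> v \<Rightarrow> 2 * s + 2)"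
    for x :: "('a, real^'b) pi_state"
  have clock_step: "clock x < clock y" if "pi_step AM f fp c x y" for x y
    using that by cases (auto simp: clock_def)
  have clock_le: "clock x \<le> 2 * N + 2" if "inv x" for x
    using that by (cases x) (auto simp: clock_def inv_def dest!: hist_le)
  show ?thesis
    unfolding pi_stops_within_def
  proof (intro ballI conjI allI impI notI)
    fix \<sigma>\<^sub>0 assume \<sigma>\<^sub>0: "\<sigma>\<^sub>0 \<in> AM"
    assume "\<exists>run. run 0 = Evaluate 0 \<sigma>\<^sub>0 \<and> (\<forall>k. pi_step AM f fp c (run k) (run (Suc k)))"
    then obtain run where run: "run 0 = Evaluate 0 \<sigma>\<^sub>0" "\<And>k. pi_step AM f fp c (run k) (run (Suc k))"
      by blast
    have inv_run: "inv (run k)" for k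
    proof (induction k)
      case 0
      then show ?case using hist_0[OF \<sigma>\<^sub>0] by (simp add: run(1) inv_def)
    qed (rule inv_step[OF run(2)])
    have "k \<le> clock (run k)" for k
    proof (induction k)
      case (Suc k)
      then show ?case using clock_step[OF run(2)[of k]] by simp
    qed simp
    from this[of "2 * N + 3"] clock_le[OF inv_run[of "2 * N + 3"]] show False by simp
  next
    fix \<sigma>\<^sub>0 x assume \<sigma>\<^sub>0: "\<sigma>\<^sub>0 \<in> AM"
    assume x: "(pi_step AM f fp c)\<^sup>*\<^sup>* (Evaluate 0 \<sigma>\<^sub>0) x \<and> (\<nexists>y. pi_step AM f fp c x y)"
    from x have "(pi_step AM f fp c)\<^sup>*\<^sup>* (Evaluate 0 \<sigma>\<^sub>0) x" ..
    then have inv: "inv x"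
    proof (induction rule: rtranclp_induct)
      case base
      show ?case using hist_0[OF \<sigma>\<^sub>0] by (simp add: inv_def)
    qed (rule inv_step)
    show "\<exists>s \<sigma> \<eta> v. x = Stopped s \<sigma> \<eta> v \<and> int s \<le> int N"
    proof (cases x)
      case (Evaluate s \<sigma>)
      then have "\<sigma> \<in> AM" using inv by (auto simp: inv_def intro: hist_AM)
      then have "\<exists>y. pi_step AM f fp c x y"
        using solvable unfolding Evaluate by (meson pi_step.evaluate)
      with x show ?thesis by blast
    next
      case (Improve s \<sigma> \<eta> v)
      then have "\<sigma> \<in> AM" using inv by (auto simp: inv_def intro: hist_AM)
      then obtain \<sigma>' where "improved_policy AM f fp \<sigma> v \<sigma>'" using improvable by blast
      then have "\<exists>y. pi_step AM f fp c x y"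
        unfolding Improve by (cases "\<sigma>' = \<sigma>") (blast intro: pi_step.stop pi_step.continue)+
      with x show ?thesis by blast
    next
      case (Stopped s \<sigma> \<eta> v)
      then show ?thesis using inv by (auto simp: inv_def dest: hist_le)
    qed
  qed
qed

section \<open>Decay and growth estimates for the iteration bound\<close>

lemma s_max_contraction:
  assumes "1 \<le> K"
  shows "\<exists>p. s_max m K = int (m * p) \<and> ((K - 1) / K) ^ p < 1 / K"
proof (cases "K = 1")
  case True
  \<comment> \<open>Here the contraction factor is 0, and p = 1 agrees with reading the quotient as
    0.\<close>
  then show ?thesis by (intro exI[of _ 1]) (simp add: s_max_def)
next
  case False
  with assms have K: "1 < K" by simp
  define q where "q = ln K / ln (K / (K - 1))"
  have l: "0 < ln (K / (K - 1))" using K by simp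
  have q: "0 \<le> q" using K l by (simp add: q_def)
  \<comment> \<open>The least integer strictly above \<open>q\<close>. Rounding up instead would
    give mere equality with 1/K when \<open>q\<close> is an integer.\<close>
  define p where "p = nat (1 + \<lfloor>q\<rfloor>)"
  have p: "int p = 1 + \<lfloor>q\<rfloor>" using q by (simp add: p_def)
  then have "s_max m K = int (m * p)" using False by (simp add: s_max_def q_def)
  moreover have "((K - 1) / K) ^ p < 1 / K"
  proof -
    have "real_of_int (int p) = 1 + real_of_int \<lfloor>q\<rfloor>" unfolding p by simp
    then have "q < real p" by linarith
    then have "ln K < real p * ln (K / (K - 1))" using l by (simp add: q_def divide_less_eq)
    also have "\<dots> = - ln (((K - 1) / K) ^ p)" using K by (simp add: ln_realpow ln_div algebra_simps)
    finally have "ln (((K - 1) / K) ^ p) < ln (1 / K)" using K by (simp add: ln_div)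
    then show ?thesis using K by (subst (asm) ln_less_cancel_iff) auto
  qed
  ultimately show ?thesis by blast
qed

text \<open>From ln t \<le> t - 1 at t = (K - 1)/K follows ln (K/(K - 1)) \<ge> 1/K, so the quotient
  is at most K ln K. For K \<ge> 3 also 1 \<le> K ln K, whence the constant 2. The filter
  \<open>top\<close> on \<open>m\<close> expresses uniformity in \<open>m\<close>.\<close>

lemma s_max_bigo:
  "(\<lambda>(m, K). real_of_int (s_max m K)) \<in> O[top \<times>\<^sub>F at_top](\<lambda>(m, K). real m * (K * ln K))"
proof (rule bigoI[of _ 2])
  have bound: "\<bar>real_of_int (s_max m K)\<bar> \<le> 2 * \<bar>real m * (K * ln K)\<bar>" if K: "3 \<le> K" for m K
  proof -
    define q where "q = ln K / ln (K / (K - 1))"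
    have lnK: "1 \<le> ln K" using K exp_le by (subst ln_ge_iff) auto
    have "ln ((K - 1) / K) \<le> (K - 1) / K - 1" using K by (intro ln_le_minus_one) simp
    also have "(K - 1) / K - 1 = - (1 / K)" using K by (simp add: field_simps)
    finally have l: "1 / K \<le> ln (K / (K - 1))" using K by (simp add: ln_div)
    have "0 < 1 / K" using K by simp
    moreover from this l have l0: "0 < ln (K / (K - 1))" by linarith
    ultimately have "q \<le> ln K / (1 / K)"
      unfolding q_def using lnK l by (intro divide_left_mono mult_pos_pos) linarith+
    then have q: "q \<le> K * ln K" by (simp add: mult.commute)
    have q0: "0 \<le> q" unfolding q_def using l0 lnK by (intro divide_nonneg_nonneg) linarith+
    have "1 * 1 \<le> K * ln K" using K lnK by (intro mult_mono) auto
    moreover have "real_of_int \<lfloor>q\<rfloor> \<le> q" by simp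
    ultimately have "1 + real_of_int \<lfloor>q\<rfloor> \<le> 2 * (K * ln K)" using q by linarith
    then have "real m * (1 + real_of_int \<lfloor>q\<rfloor>) \<le> real m * (2 * (K * ln K))"
      by (intro mult_left_mono) auto
    moreover have "real_of_int (s_max m K) = real m * (1 + real_of_int \<lfloor>q\<rfloor>)"
      using K by (simp add: s_max_def q_def)
    moreover have "0 \<le> real m * (1 + real_of_int \<lfloor>q\<rfloor>)" using q0 by simp
    ultimately show ?thesis by simp
  qed
  show "\<forall>\<^sub>F x in top \<times>\<^sub>F at_top. norm (case x of (m, K) \<Rightarrow> real_of_int (s_max m K))
      \<le> 2 * norm (case x of (m, K) \<Rightarrow> real m * (K * ln K))"
    unfolding eventually_prod_filter
  proof (intro exI conjI allI impI)
    show "\<forall>\<^sub>F K in at_top. (3::real) \<le> K" by (rule eventually_ge_at_top)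
    show "\<forall>\<^sub>F m in top. True" by simp
  qed (use bound in auto)
qed

section \<open>Policies as a product set\<close>

lemma ex_policy_through:
  assumes "\<And>i. A i \<noteq> {}" "a \<in> A i"
  shows "\<exists>\<sigma>\<in>policies A. \<sigma> i = a"
proof -
  have "\<forall>j. \<exists>b. b \<in> A j \<and> (j = i \<longrightarrow> b = a)" using assms by (metis ex_in_conv)
  then obtain \<sigma> where "\<forall>j. \<sigma> j \<in> A j \<and> (j = i \<longrightarrow> \<sigma> j = a)" by (rule choice[THEN exE])
  then show ?thesis by (intro bexI[of _ \<sigma>]) (auto simp: policies_def)
qed

text \<open>Every action at \<open>i\<close> extends to a policy, so both minima run over the same
  values.\<close>

lemma min_map_nth:
  assumes "\<And>i. A i \<noteq> {}"
  shows "min_map A F v $ i = (MIN a\<in>A i. F v i a)"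
proof -
  have "(\<lambda>\<sigma>. policy_map F \<sigma> v $ i) ` policies A = F v i ` A i"
    using ex_policy_through[OF assms] by (force simp: policy_map_def policies_def)
  then show ?thesis by (simp add: min_map_def)
qed

lemma finite_policies:
  assumes "\<And>i. finite (A i)"
  shows "finite (policies (A :: 'n::finite \<Rightarrow> 'a set))"
proof -
  have "policies A = PiE UNIV A" by (auto simp: policies_def PiE_UNIV_domain)
  then show ?thesis using assms by (simp add: finite_PiE)
qed

text \<open>The policy switches its action at \<open>i\<close> alone. Each coordinate of the new map
  is one of the two old maps'; as their covers may differ, \<open>imD_row_transfer\<close> carries
  the rows over.\<close>

lemma matrix_family_rows:
  assumes poly: "\<And>\<sigma>. \<sigma> \<in> policies A \<Longrightarrow> polyhedral_map (policy_map F \<sigma>)"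
    and M: "M \<in> matrix_family A F" "M' \<in> matrix_family A F"
  shows "(\<chi> k. if k = i then M' $ k else M $ k) \<in> matrix_family A F"
proof -
  obtain \<sigma> \<sigma>' where \<sigma>: "\<sigma> \<in> policies A" "M \<in> rectangular_hull (imD (policy_map F \<sigma>))"
    and \<sigma>': "\<sigma>' \<in> policies A" "M' \<in> rectangular_hull (imD (policy_map F \<sigma>'))"
    using M by (auto simp: matrix_family_def)
  define \<rho> where "\<rho> = \<sigma>(i := \<sigma>' i)"
  have \<rho>: "\<rho> \<in> policies A" using \<sigma>(1) \<sigma>'(1) by (auto simp: \<rho>_def policies_def)
  have "\<exists>N\<in>imD (policy_map F \<rho>). (if k = i then M' $ k else M $ k) = N $ k" for k
  proof (cases "k = i")
    case True
    obtain N where "N \<in> imD (policy_map F \<sigma>')" "M' $ k = N $ k"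
      using \<sigma>'(2) by (auto simp: rectangular_hull_def row_eq_nth)
    with imD_row_transfer[OF poly[OF \<sigma>'(1)] poly[OF \<rho>], of k N] True show ?thesis
      by (auto simp: policy_map_def \<rho>_def)
  next
    case False
    obtain N where "N \<in> imD (policy_map F \<sigma>)" "M $ k = N $ k"
      using \<sigma>(2) by (auto simp: rectangular_hull_def row_eq_nth)
    with imD_row_transfer[OF poly[OF \<sigma>(1)] poly[OF \<rho>], of k N] False show ?thesis
      by (auto simp: policy_map_def \<rho>_def)
  qed
  then have "(\<chi> k. if k = i then M' $ k else M $ k) \<in> rectangular_hull (imD (policy_map F \<rho>))"
    by (simp only: rectangular_hull_def row_eq_nth vec_lambda_beta mem_Collect_eq) blast
  then show ?thesis using \<rho> unfolding matrix_family_def by blast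
qed

theorem corollary15:
  fixes A :: "'n::finite \<Rightarrow> 'a set"
    and F :: "real^'n \<Rightarrow> 'n \<Rightarrow> 'a \<Rightarrow> real"
    and c :: 'n
  assumes "\<And>i. finite (A i)" and "\<And>i. A i \<noteq> {}"
    and "\<And>\<sigma>. \<sigma> \<in> policies A \<Longrightarrow> additively_homogeneous (policy_map F \<sigma>)"
    and "\<And>\<sigma>. \<sigma> \<in> policies A \<Longrightarrow> mono (policy_map F \<sigma>)"
    and "\<And>\<sigma>. \<sigma> \<in> policies A \<Longrightarrow> polyhedral_map (policy_map F \<sigma>)"
    and "\<And>M. M \<in> matrix_family A F \<Longrightarrow> \<exists>!C. final_class M C"
    and "\<And>M C. M \<in> matrix_family A F \<Longrightarrow> final_class M C \<Longrightarrow> c \<in> C"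
  shows "(\<forall>M\<in>matrix_family A F. markov_matrix M) \<and>
    (\<forall>i. max_hitting_time (matrix_family A F) i c < \<infinity>) \<and>
    pi_stops_within (policies A) (min_map A F) (policy_map F) c
      (s_max (card (SIGMA i:UNIV. A i) - CARD('n)) (hitting_bound (matrix_family A F) c)) \<and>
    (\<lambda>(m, K). real_of_int (s_max m K)) \<in> O[top \<times>\<^sub>F at_top](\<lambda>(m, K). real m * (K * ln K))"
proof -
  note fin = assms(1) and ne = assms(2) and hom = assms(3) and mono = assms(4) and poly = assms(5)
  let ?\<M> = "matrix_family A F"
  have imD_family: "imD (policy_map F \<sigma>) \<subseteq> ?\<M>" if "\<sigma> \<in> policies A" for \<sigma>
    using that by (auto simp: matrix_family_def rectangular_hull_def)
  have markov: "markov_matrix M" if M: "M \<in> ?\<M>" for M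
  proof -
    obtain \<sigma> where \<sigma>: "\<sigma> \<in> policies A" "M \<in> rectangular_hull (imD (policy_map F \<sigma>))"
      using M by (auto simp: matrix_family_def)
    have "\<exists>N. markov_matrix N \<and> M $ i = N $ i" for i
      using \<sigma> markov_matrix_imD[OF hom mono]
      by (auto simp: rectangular_hull_def row_eq_nth) metis
    then show ?thesis unfolding markov_matrix_def by metis
  qed
  have reach: "(i, c) \<in> (transition_rel M)\<^sup>*" if "M \<in> ?\<M>" for M i
    using final_class_reachable[of M i] assms(7)[OF that] by blast
  have fin_\<M>: "finite ?\<M>"
    unfolding matrix_family_def
    using finite_policies[of A] fin poly by (auto intro: finite_rectangular_hull finite_imD)
  obtain a where "a \<in> A c" using ne by blast
  then have "policies A \<noteq> {}" using ex_policy_through[of A, OF ne] by blast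
  then have "?\<M> \<noteq> {}" using imD_family imD_nonempty[OF poly] by blast
  then obtain \<phi> where \<phi>: "\<And>i. 1 \<le> \<phi> i" "\<And>i. max_hitting_time ?\<M> i c = ennreal (\<phi> i)"
    and super: "\<And>M i. M \<in> ?\<M> \<Longrightarrow> 1 + taboo_apply M c \<phi> i \<le> \<phi> i"
    using max_hitting_time_supersolution[OF fin_\<M> _ markov reach matrix_family_rows[OF poly]] by blast
  define K where "K = hitting_bound ?\<M> c"
  obtain k where k: "\<And>j. \<phi> j \<le> \<phi> k" using ex_argmax[of \<phi>] by blast
  \<comment> \<open>The maximum is finite, so \<open>enn2real\<close> does not fall back on its
    value 0 at infinity.\<close>
  have "(MAX i\<in>UNIV. ennreal (\<phi> i)) = ennreal (\<phi> k)"
    using k by (intro Max_eqI) (auto intro: ennreal_leI)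
  moreover have "0 \<le> \<phi> k" using \<phi>(1)[of k] by simp
  ultimately have "K = \<phi> k" by (simp add: K_def hitting_bound_def \<phi>(2))
  then have K: "\<phi> j \<le> K" "1 \<le> K" for j using k \<phi>(1) by auto
  define V where "V x = (\<chi> j. \<phi> j * (x j - x c))" for x
  \<comment> \<open>The rescaled operator split by actions: for a = \<sigma> i it is the discounted
    operator of the policy \<sigma>.\<close>
  define G where "G x i a = (F (V x) i a + (\<phi> i - 1) * x c) / \<phi> i" for x i a
  define \<gamma> where "\<gamma> = (K - 1) / K"
  have \<gamma>: "0 \<le> \<gamma>" "\<gamma> < 1" "1 - \<gamma> = 1 / K" using K(2) by (auto simp: \<gamma>_def field_simps)
  have G: "discounted \<gamma> (\<lambda>x i. G x i (\<sigma> i))" if \<sigma>: "\<sigma> \<in> policies A" for \<sigma>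
    using discounted_rescaled[OF poly[OF \<sigma>] markov \<phi>(1) K(1) super] imD_family[OF \<sigma>]
    by (auto simp: \<gamma>_def G_def V_def policy_map_def)
  let ?m = "card (SIGMA i:UNIV. A i) - CARD('n)"
  obtain p where p: "s_max ?m K = int (?m * p)" "\<gamma> ^ p < 1 - \<gamma>"
    using s_max_contraction[OF K(2)] unfolding \<gamma>(3) unfolding \<gamma>_def by blast
  have "pi_stops_within (policies A) (min_map A F) (policy_map F) c (int (?m * p))"
  proof (rule pi_stops_withinI)
    fix \<sigma> assume \<sigma>: "\<sigma> \<in> policies A"
    obtain x where "\<And>i. G x i (\<sigma> i) = x i"
      using discounted_fixpoint[OF G[OF \<sigma>] \<gamma>(2)] by blast
    then have "solves_eigenproblem (policy_map F \<sigma>) c (x c) (\<chi> j. \<phi> j * (x j - x c))"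
      by (intro fixpoint_imp_eigenpair \<phi>(1)) (simp add: G_def V_def policy_map_def)
    then show "\<exists>\<eta> v. solves_eigenproblem (policy_map F \<sigma>) c \<eta> v" by blast
  next
    fix \<sigma> v assume \<sigma>: "\<sigma> \<in> policies A"
    have "\<exists>a\<in>A i. (MIN a\<in>A i. F v i a) = F v i a" for i
      using Min_in[of "F v i ` A i"] fin ne by fastforce
    then obtain \<rho> where "\<And>i. \<rho> i \<in> A i" "\<And>i. (MIN a\<in>A i. F v i a) = F v i (\<rho> i)" by metis
    then have "\<rho> \<in> policies A" "min_map A F v = policy_map F \<rho> v"
      by (auto simp: policies_def vec_eq_iff min_map_nth[OF ne] policy_map_def)
    \<comment> \<open>If \<sigma> attains the minimum, the rule demands \<sigma> itself; otherwise
      \<rho> will do.\<close>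
    with \<sigma> show "\<exists>\<sigma>'. improved_policy (policies A) (min_map A F) (policy_map F) \<sigma> v \<sigma>'"
      unfolding improved_policy_def by metis
  next
    fix \<tau> \<eta> v s
    assume \<tau>: "\<And>t. t \<le> s \<Longrightarrow> \<tau> t \<in> policies A"
      and sol: "\<And>t. t < s \<Longrightarrow> solves_eigenproblem (policy_map F (\<tau> t)) c (\<eta> t) (v t)"
      and imp: "\<And>t. t < s \<Longrightarrow>
        improved_policy (policies A) (min_map A F) (policy_map F) (\<tau> t) (v t) (\<tau> (Suc t))"
      and new: "\<And>t. t < s \<Longrightarrow> \<tau> (Suc t) \<noteq> \<tau> t"
    define x where "x t i = v t $ i / \<phi> i + \<eta> t" for t i
    have V: "V (x t) = v t" and xc: "x t c = \<eta> t"
      and fix_x: "G (x t) i (\<tau> t i) = x t i" if "t < s" for t i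
      using eigenpair_imp_fixpoint[OF \<phi>(1) sol[OF that] x_def]
      by (auto simp: V_def G_def policy_map_def)
    have \<phi>0: "0 < \<phi> i" for i using \<phi>(1)[of i] by simp
    \<comment> \<open>At fixed \<open>x t\<close>, \<open>G\<close> is an increasing affine function
      of \<open>F\<close>, so both problems have the same greedy actions.\<close>
    have G_le: "G (x t) i a \<le> G (x t) i b \<longleftrightarrow> F (v t) i a \<le> F (v t) i b" if "t < s" for t i a b
      using V[OF that] \<phi>0[of i] by (simp add: G_def divide_le_cancel)
    have greedy: "F (v t) i (\<tau> (Suc t) i) = (MIN a\<in>A i. F (v t) i a)" if "t < s" for t i
      using imp[OF that] unfolding improved_policy_def vec_eq_iff
      by (simp add: min_map_nth[OF ne] policy_map_def)
    show "s \<le> ?m * p"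
    proof (rule policy_iteration_length[where A = A and G = G and \<tau> = \<tau> and x = x, OF fin ne G \<gamma>(1,2) p(2) \<tau> fix_x])
      show "G (x t) i (\<tau> (Suc t) i) \<le> G (x t) i a" if "t < s" "a \<in> A i" for t i a
        unfolding G_le[OF that(1)] greedy[OF that(1)] using fin that(2) by simp
      show "\<exists>i. \<exists>a\<in>A i. G (x t) i a < G (x t) i (\<tau> t i)" if t: "t < s" for t
      proof -
        \<comment> \<open>Here the rule of keeping the policy whenever possible enters: a change
          means that the old policy was not greedy.\<close>
        have "min_map A F (v t) \<noteq> policy_map F (\<tau> t) (v t)"
          using imp[OF t] new[OF t] by (auto simp: improved_policy_def)
        then obtain i where i: "(MIN a\<in>A i. F (v t) i a) \<noteq> F (v t) i (\<tau> t i)"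
          by (auto simp: vec_eq_iff min_map_nth[OF ne] policy_map_def)
        have A: "\<tau> t i \<in> A i" "\<tau> (Suc t) i \<in> A i" using \<tau> t by (auto simp: policies_def)
        then have "(MIN a\<in>A i. F (v t) i a) \<le> F (v t) i (\<tau> t i)" using fin by simp
        with i have "F (v t) i (\<tau> (Suc t) i) < F (v t) i (\<tau> t i)" using greedy[OF t] by simp
        then have "G (x t) i (\<tau> (Suc t) i) < G (x t) i (\<tau> t i)"
          using G_le[OF t] by (simp add: not_le[symmetric])
        with A show ?thesis by blast
      qed
    qed
  qed
  then show ?thesis
    using markov \<phi>(2) s_max_bigo p(1) unfolding K_def[symmetric] by simp
qed

end
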